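(* Let $G=\langle S\mid T\rangle$ be a finite presentation of a hyperbolic group, and let $\mathcal{L}^{G}\subseteq (S\sqcup S^{-1})^*$ be a language such that (1) $\mathcal{L}^G$ is regular, prefix closed and suffix closed, and consists of geodesic words, and (2) for every $l\geq 1$ the set $\mathcal{L}^G_l$ of words of length $l$ in $\mathcal{L}^G$ generates a finite index subgroup of $G$. Let $R=\{r=(x_r,y_r,z_r)\}_r$ be a finite set of triples of elements of $\mathcal{L}^{G}$ such that for each $r\in R$: $x_ry_rz_r$ is reduced without cancellation and lies in $\mathcal{L}^G$, and each of $x_r,y_r,z_r$ is reduced and is not the empty word. Suppose that $\mathcal{W}(R)=\bigcup_{r\in R}\{x_r,y_r,z_r\}$ generates a finite index subgroup of $G$, and let $\mathcal{R}=\{x_ry_rz_r : r\in R\}$. Suppose that there exist constants $\epsilon,\delta>0$ such that for all $g\in G$ with $g\in V(\Upsilon(G,\mathcal{L}^G,R))$: $$deg(g)\leq (1+\epsilon)\,deg(g^{-1})\quad\text{and}\quad rep(g)\leq (1+\delta)\,deg(g).$$ If $$\lambda_1\big(\Upsilon(G,\mathcal{L}^G,R)\big)>\frac{1+\delta}{2-4\epsilon^2},$$ then $G/\langle\langle \mathcal{R}\rangle\rangle$ has Property (T).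
   Context: A language is regular if it is recognised by a finite state automaton, prefix closed if $uv\in\mathcal{L}$ implies $u\in\mathcal{L}$, and suffix closed if $uv\in\mathcal{L}$ implies $v\in\mathcal{L}$. For a word $w$, $\overline{w}$ denotes its image in $G$ and $w^{-1}$ its formal inverse word. $\langle\langle \mathcal{R}\rangle\rangle$ is the normal closure of $\mathcal{R}$ in $G$. The directed graph $\Upsilon=\Upsilon(G,\mathcal{L}^G,R)$ (multiple edges and loops allowed) has vertex set $V=V(\Upsilon)=\mathcal{W}(R)\cup\{w^{-1} : w\in\mathcal{W}(R)\}$ (a set of words). For each triple $r=(x_r,y_r,z_r)\in R$ add the two directed edges $(x_r,z_r^{-1})$ and $(z_r^{-1},x_r)$. For $g\in G$ we write $g\in V(\Upsilon)$ if there is $w\in V(\Upsilon)$ with $\overline{w}=g$. For a vertex $w$, $deg_{\Upsilon}(w)$ is the number of directed edges starting at $w$, and $rep(w)=|\{(u,w,v)\in R\}|+|\{(u,w^{-1},v)\in R\}|$. For $g\in G$: $deg(g)=\sum_{w\in V,\,\overline{w}=g}deg_{\Upsilon}(w)$ and $rep(g)=\sum_{w\in V,\,\overline{w}=g}rep(w)$. $A(\Upsilon)$ is the adjacency matrix ($A_{i,j}$ is the number of directed edges from $v_i$ to $v_j$; it is symmetric), $D(\Upsilon)$ is the diagonal matrix of degrees, and $L(\Upsilon)=I-D^{-1/2}AD^{-1/2}$ has real eigenvalues in $[0,2]$, ordered $\lambda_0\leq\lambda_1\leq\cdots$ with multiplicity; $\lambda_1(\Upsilon)$ is the second smallest. A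 finitely generated group $\Gamma$ with finite generating set $A$ has Property (T) if every unitary representation $\pi$ of $\Gamma$ on a Hilbert space with almost-invariant vectors (for every $\eta>0$ there is a non-zero $u$ with $\|\pi(a)u-u\|<\eta\|u\|$ for all $a\in A$) has a non-zero invariant vector.
   Formalization: The formal theorem adds the assumption 2 − 4ε² > 0: at ε² = 1/2 the bound is undefined, and for ε² > 1/2 it is negative, so the spectral condition is void and the claim fails (e.g. a quotient of F₂ by words in [F₂,F₂], which maps onto Z²). *)

theory Defs
  imports
    "HOL-Algebra.Coset"
    "HOL-Algebra.Generated_Groups"
    "Graph_Theory.Digraph"
    "Jordan_Normal_Form.Char_Poly"
begin

section \<open>Words and group presentations\<close>

text \<open>A letter \<open>(s, True)\<close> stands for the generator \<open>s\<close> and \<open>(s, False)\<close> for its formal inverse.\<close>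

type_synonym 'a letter = "'a \<times> bool"
type_synonym 'a word = "'a letter list"

definition letters :: "'a set \<Rightarrow> 'a letter set" where
  "letters S = S \<times> UNIV"

definition inv_letter :: "'a letter \<Rightarrow> 'a letter" where
  "inv_letter a = (fst a, \<not> snd a)"

definition inv_word :: "'a word \<Rightarrow> 'a word" where
  "inv_word w = rev (map inv_letter w)"

definition reduced :: "'a word \<Rightarrow> bool" where
  "reduced w \<longleftrightarrow> successively (\<lambda>a b. b \<noteq> inv_letter a) w"

inductive word_eq :: "'a set \<Rightarrow> 'a word set \<Rightarrow> 'a word \<Rightarrow> 'a word \<Rightarrow> bool"
  for S :: "'a set" and T :: "'a word set" where
  refl: "w \<in> lists (letters S) \<Longrightarrow> word_eq S T w w"
| sym: "word_eq S T u v \<Longrightarrow> word_eq S T v u"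
| trans: "word_eq S T u v \<Longrightarrow> word_eq S T v w \<Longrightarrow> word_eq S T u w"
| cancel: "u \<in> lists (letters S) \<Longrightarrow> v \<in> lists (letters S) \<Longrightarrow> a \<in> letters S \<Longrightarrow>
    word_eq S T (u @ [a, inv_letter a] @ v) (u @ v)"
| relator: "u \<in> lists (letters S) \<Longrightarrow> v \<in> lists (letters S) \<Longrightarrow> t \<in> T \<Longrightarrow>
    word_eq S T (u @ t @ v) (u @ v)"

definition word_rel :: "'a set \<Rightarrow> 'a word set \<Rightarrow> ('a word \<times> 'a word) set" where
  "word_rel S T = {(u, v). word_eq S T u v}"

text \<open>The image of a word in the presented group.\<close>

definition word_img :: "'a set \<Rightarrow> 'a word set \<Rightarrow> 'a word \<Rightarrow> 'a word set" where
  "word_img S T w = word_rel S T `` {w}"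

definition presented_group :: "'a set \<Rightarrow> 'a word set \<Rightarrow> 'a word set monoid" where
  "presented_group S T =
    \<lparr>carrier = lists (letters S) // word_rel S T,
     monoid.mult = (\<lambda>X Y. \<Union>u\<in>X. \<Union>v\<in>Y. word_img S T (u @ v)),
     one = word_img S T []\<rparr>"

definition finite_presentation :: "'a set \<Rightarrow> 'a word set \<Rightarrow> bool" where
  "finite_presentation S T \<longleftrightarrow> finite S \<and> finite T \<and> T \<subseteq> lists (letters S)"

lemma inv_letter_in: "a \<in> letters S \<Longrightarrow> inv_letter a \<in> letters S"
  by (auto simp: letters_def inv_letter_def)

lemma inv_letter_inv_letter [simp]: "inv_letter (inv_letter a) = a"
  by (simp add: inv_letter_def)

lemma inv_word_in: "w \<in> lists (letters S) \<Longrightarrow> inv_word w \<in> lists (letters S)"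
  unfolding inv_word_def in_lists_conv_set set_rev set_map using inv_letter_in by blast

lemma inv_word_inv_word [simp]: "inv_word (inv_word w) = w"
  by (simp add: inv_word_def rev_map o_def)

lemma word_eq_in:
  assumes "T \<subseteq> lists (letters S)" "word_eq S T u v"
  shows "u \<in> lists (letters S) \<and> v \<in> lists (letters S)"
  using assms(2)
proof induction
  case (cancel u v a)
  then show ?case using inv_letter_in[of a S] by auto
next
  case (relator u v t)
  then show ?case using assms(1) by auto
qed auto

lemma word_eq_context:
  assumes "word_eq S T u v" "p \<in> lists (letters S)" "q \<in> lists (letters S)"
  shows "word_eq S T (p @ u @ q) (p @ v @ q)"
  using assms(1)
proof induction
  case (refl w)
  then show ?case using assms by (intro word_eq.refl) auto
next
  case (cancel u v a)
  then show ?case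
    using word_eq.cancel[of "p @ u" S "v @ q" a T] assms by auto
next
  case (relator u v t)
  then show ?case
    using word_eq.relator[of "p @ u" S "v @ q" t T] assms by auto
next
  case (sym u v)
  from sym.IH show ?case by (rule word_eq.sym)
next
  case (trans u v w)
  from trans.IH show ?case by (rule word_eq.trans)
qed

lemma word_eq_append:
  assumes T: "T \<subseteq> lists (letters S)" and "word_eq S T u u'" "word_eq S T v v'"
  shows "word_eq S T (u @ v) (u' @ v')"
proof -
  have "word_eq S T (u @ v) (u' @ v)"
    using word_eq_context[OF assms(2), of "[]" v] word_eq_in[OF T assms(3)] by simp
  moreover have "word_eq S T (u' @ v) (u' @ v')"
    using word_eq_context[OF assms(3), of u' "[]"] word_eq_in[OF T assms(2)] by simp
  ultimately show ?thesis by (rule word_eq.trans)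
qed

lemma word_eq_inv: "w \<in> lists (letters S) \<Longrightarrow> word_eq S T (w @ inv_word w) []"
proof (induction w)
  case Nil
  then show ?case by (simp add: inv_word_def word_eq.refl)
next
  case (Cons a w)
  then have a: "a \<in> letters S" and w: "w \<in> lists (letters S)" by auto
  have 1: "word_eq S T ([a] @ (w @ inv_word w) @ [inv_letter a]) ([a] @ [] @ [inv_letter a])"
    using Cons.IH w a inv_letter_in[OF a] by (intro word_eq_context) auto
  have 2: "word_eq S T ([] @ [a, inv_letter a] @ []) ([] @ [])"
    using a by (intro word_eq.cancel) auto
  have "word_eq S T ([a] @ (w @ inv_word w) @ [inv_letter a]) []"
    by (rule word_eq.trans[OF 1]) (use 2 in simp)
  then show ?case by (simp add: inv_word_def)
qed

lemma equiv_word_rel: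
  assumes "T \<subseteq> lists (letters S)"
  shows "equiv (lists (letters S)) (word_rel S T)"
proof (rule equivI)
  show "word_rel S T \<subseteq> lists (letters S) \<times> lists (letters S)"
  proof (rule subrelI)
    fix u v
    assume "(u, v) \<in> word_rel S T"
    then have "word_eq S T u v" by (simp add: word_rel_def)
    from word_eq_in[OF assms this] show "(u, v) \<in> lists (letters S) \<times> lists (letters S)"
      by (rule conjE) (rule SigmaI)
  qed
  show "refl_on (lists (letters S)) (word_rel S T)"
    by (rule refl_onI) (simp add: word_rel_def word_eq.refl)
  show "sym (word_rel S T)"
    by (rule symI) (simp add: word_rel_def word_eq.sym)
  show "trans (word_rel S T)"
    unfolding word_rel_def by (rule transI) (simp, rule word_eq.trans)
qed

lemma word_img_eq_iff:
  assumes "T \<subseteq> lists (letters S)" "u \<in> lists (letters S)" "v \<in> lists (letters S)"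
  shows "word_img S T u = word_img S T v \<longleftrightarrow> word_eq S T u v"
  unfolding word_img_def
  using eq_equiv_class_iff[OF equiv_word_rel[OF assms(1)] assms(2,3)] by (simp add: word_rel_def)

lemma word_img_mult:
  assumes T: "T \<subseteq> lists (letters S)" and u: "u \<in> lists (letters S)" and v: "v \<in> lists (letters S)"
  shows "word_img S T u \<otimes>\<^bsub>presented_group S T\<^esub> word_img S T v = word_img S T (u @ v)"
proof -
  have "word_img S T (u' @ v') = word_img S T (u @ v)"
    if "u' \<in> word_img S T u" "v' \<in> word_img S T v" for u' v'
  proof -
    from that have "word_eq S T u u'" "word_eq S T v v'" by (auto simp: word_img_def word_rel_def)
    then have eq: "word_eq S T (u @ v) (u' @ v')" by (rule word_eq_append[OF T])
    with word_eq_in[OF T eq] show ?thesis by (simp add: word_img_eq_iff[OF T] word_eq.sym)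
  qed
  moreover have "u \<in> word_img S T u" "v \<in> word_img S T v"
    using u v by (auto simp: word_img_def word_rel_def intro: word_eq.refl)
  ultimately have "(\<Union>u'\<in>word_img S T u. \<Union>v'\<in>word_img S T v. word_img S T (u' @ v')) =
      word_img S T (u @ v)"
    by blast
  then show ?thesis by (simp add: presented_group_def)
qed

lemma carrier_presented_group:
  "carrier (presented_group S T) = word_img S T ` lists (letters S)"
  by (auto simp: presented_group_def quotient_def word_img_def)

lemma group_presented_group:
  assumes T: "T \<subseteq> lists (letters S)"
  shows "group (presented_group S T)"
proof (rule groupI)
  let ?G = "presented_group S T"
  have one: "\<one>\<^bsub>?G\<^esub> = word_img S T []" by (simp add: presented_group_def)
  have carrierE: "\<exists>w\<in>lists (letters S). x = word_img S T w" if "x \<in> carrier ?G" for x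
    using that unfolding carrier_presented_group by (rule imageE) (rule bexI)
  have img_in: "word_img S T w \<in> carrier ?G" if "w \<in> lists (letters S)" for w
    using that unfolding carrier_presented_group by (rule imageI)
  have app_in: "u @ v \<in> lists (letters S)"
    if "u \<in> lists (letters S)" "v \<in> lists (letters S)" for u v :: "'a word"
    using that by simp
  show "\<one>\<^bsub>?G\<^esub> \<in> carrier ?G" unfolding one by (rule img_in) simp
  show "x \<otimes>\<^bsub>?G\<^esub> y \<in> carrier ?G" if "x \<in> carrier ?G" "y \<in> carrier ?G" for x y
    using carrierE[OF that(1)] carrierE[OF that(2)] by (metis word_img_mult[OF T] img_in app_in)
  show "x \<otimes>\<^bsub>?G\<^esub> y \<otimes>\<^bsub>?G\<^esub> z = x \<otimes>\<^bsub>?G\<^esub> (y \<otimes>\<^bsub>?G\<^esub> z)"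
    if "x \<in> carrier ?G" "y \<in> carrier ?G" "z \<in> carrier ?G" for x y z
    using carrierE[OF that(1)] carrierE[OF that(2)] carrierE[OF that(3)]
    by (metis word_img_mult[OF T] app_in append_assoc)
  show "\<one>\<^bsub>?G\<^esub> \<otimes>\<^bsub>?G\<^esub> x = x" if "x \<in> carrier ?G" for x
    using carrierE[OF that] unfolding one
    by (metis word_img_mult[OF T] append_Nil lists.Nil)
  show "\<exists>y\<in>carrier ?G. y \<otimes>\<^bsub>?G\<^esub> x = \<one>\<^bsub>?G\<^esub>" if "x \<in> carrier ?G" for x
  proof -
    from carrierE[OF that] obtain w where w: "w \<in> lists (letters S)" "x = word_img S T w" ..
    have "word_eq S T (inv_word w @ w) []"
      using word_eq_inv[OF inv_word_in[OF w(1)]] by simp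
    then have "word_img S T (inv_word w) \<otimes>\<^bsub>?G\<^esub> x = \<one>\<^bsub>?G\<^esub>"
      unfolding one w(2) word_img_mult[OF T inv_word_in[OF w(1)] w(1)]
      using word_img_eq_iff[OF T app_in[OF inv_word_in[OF w(1)] w(1)]] by simp
    then show ?thesis using img_in[OF inv_word_in[OF w(1)]] by blast
  qed
qed

section \<open>Word metric and hyperbolicity\<close>

definition word_norm :: "'a set \<Rightarrow> 'a word set \<Rightarrow> 'a word set \<Rightarrow> nat" where
  "word_norm S T g = (LEAST n. \<exists>w\<in>lists (letters S). word_img S T w = g \<and> length w = n)"

definition word_dist :: "'a set \<Rightarrow> 'a word set \<Rightarrow> 'a word set \<Rightarrow> 'a word set \<Rightarrow> real" where
  "word_dist S T g h =
    real (word_norm S T (inv\<^bsub>presented_group S T\<^esub> g \<otimes>\<^bsub>presented_group S T\<^esub> h))"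

definition gromov_product :: "('x \<Rightarrow> 'x \<Rightarrow> real) \<Rightarrow> 'x \<Rightarrow> 'x \<Rightarrow> 'x \<Rightarrow> real" where
  "gromov_product d p x y = (d p x + d p y - d x y) / 2"

definition gromov_hyperbolic :: "'x set \<Rightarrow> ('x \<Rightarrow> 'x \<Rightarrow> real) \<Rightarrow> bool" where
  "gromov_hyperbolic X d \<longleftrightarrow> (\<exists>\<kappa>\<ge>0. \<forall>p\<in>X. \<forall>x\<in>X. \<forall>y\<in>X. \<forall>z\<in>X.
     gromov_product d p x z \<ge> min (gromov_product d p x y) (gromov_product d p y z) - \<kappa>)"

definition hyperbolic_presentation :: "'a set \<Rightarrow> 'a word set \<Rightarrow> bool" where
  "hyperbolic_presentation S T \<longleftrightarrow>
     gromov_hyperbolic (carrier (presented_group S T)) (word_dist S T)"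

definition geodesic_word :: "'a set \<Rightarrow> 'a word set \<Rightarrow> 'a word \<Rightarrow> bool" where
  "geodesic_word S T w \<longleftrightarrow>
     w \<in> lists (letters S) \<and> length w = word_norm S T (word_img S T w)"

section \<open>Languages\<close>

text \<open>Recognition by a deterministic automaton; every finite state set can be taken inside \<open>nat\<close>.\<close>

definition regular_language :: "'b set \<Rightarrow> 'b list set \<Rightarrow> bool" where
  "regular_language \<Sigma> L \<longleftrightarrow>
     (\<exists>(Q :: nat set) q0 F \<tau>. finite Q \<and> q0 \<in> Q \<and> F \<subseteq> Q \<and> (\<forall>q\<in>Q. \<forall>a\<in>\<Sigma>. \<tau> q a \<in> Q) \<and>
        L = {w \<in> lists \<Sigma>. foldl \<tau> q0 w \<in> F})"

definition prefix_closed :: "'b list set \<Rightarrow> bool" where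
  "prefix_closed L \<longleftrightarrow> (\<forall>u v. u @ v \<in> L \<longrightarrow> u \<in> L)"

definition suffix_closed :: "'b list set \<Rightarrow> bool" where
  "suffix_closed L \<longleftrightarrow> (\<forall>u v. u @ v \<in> L \<longrightarrow> v \<in> L)"

section \<open>Subgroups\<close>

definition finite_index :: "('g, 'm) monoid_scheme \<Rightarrow> 'g set \<Rightarrow> bool" where
  "finite_index G H \<longleftrightarrow> subgroup H G \<and> finite (rcosets\<^bsub>G\<^esub> H)"

definition normal_closure :: "('g, 'm) monoid_scheme \<Rightarrow> 'g set \<Rightarrow> 'g set" where
  "normal_closure G K = \<Inter>{N. N \<lhd> G \<and> K \<subseteq> N}"

section \<open>Normalised Laplacian of a finite directed multigraph\<close>

text \<open>An arbitrary enumeration of the vertices; the characteristic polynomial of the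
  Laplacian does not depend on it.\<close>

definition vertex_list :: "('v, 'e) pre_digraph \<Rightarrow> 'v list" where
  "vertex_list \<Gamma> = (SOME vs. distinct vs \<and> set vs = verts \<Gamma>)"

definition adjacency_matrix :: "('v, 'e) pre_digraph \<Rightarrow> real mat" where
  "adjacency_matrix \<Gamma> = (let vs = vertex_list \<Gamma>; n = length vs in
     mat n n (\<lambda>(i, j). real (card {e \<in> arcs \<Gamma>. tail \<Gamma> e = vs ! i \<and> head \<Gamma> e = vs ! j})))"

text \<open>The matrix \<open>D\<^sup>-\<^sup>1\<^sup>/\<^sup>2\<close>. Division by zero makes the entry of an isolated vertex \<open>0\<close>, so that
  such a vertex contributes an eigenvalue \<open>1\<close> to the Laplacian.\<close>

definition inv_sqrt_degree_matrix :: "('v, 'e) pre_digraph \<Rightarrow> real mat" where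
  "inv_sqrt_degree_matrix \<Gamma> = (let vs = vertex_list \<Gamma>; n = length vs in
     mat n n (\<lambda>(i, j). if i = j then 1 / sqrt (real (out_degree \<Gamma> (vs ! i))) else 0))"

definition laplacian :: "('v, 'e) pre_digraph \<Rightarrow> real mat" where
  "laplacian \<Gamma> = 1\<^sub>m (length (vertex_list \<Gamma>)) -
     inv_sqrt_degree_matrix \<Gamma> * adjacency_matrix \<Gamma> * inv_sqrt_degree_matrix \<Gamma>"

text \<open>The eigenvalues in increasing order, repeated according to their multiplicity, are the
  sorted roots of the characteristic polynomial; \<open>\<lambda>\<^sub>1\<close> is the entry with index 1.\<close>

definition lambda1 :: "('v, 'e) pre_digraph \<Rightarrow> real" where
  "lambda1 \<Gamma> = sorted_list_of_multiset (proots (char_poly (laplacian \<Gamma>))) ! 1"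

section \<open>The graph of a set of triples\<close>

type_synonym 'a triple = "'a word \<times> 'a word \<times> 'a word"

definition triple_words :: "'a triple set \<Rightarrow> 'a word set" where
  "triple_words R = (\<Union>(x, y, z)\<in>R. {x, y, z})"

definition relator_words :: "'a triple set \<Rightarrow> 'a word set" where
  "relator_words R = (\<lambda>(x, y, z). x @ y @ z) ` R"

text \<open>The arcs \<open>((x, y, z), True)\<close> and \<open>((x, y, z), False)\<close> are the two directed edges
  \<open>(x, z\<^sup>-\<^sup>1)\<close> and \<open>(z\<^sup>-\<^sup>1, x)\<close> coming from the triple \<open>(x, y, z)\<close>.\<close>

definition Upsilon :: "'a triple set \<Rightarrow> ('a word, 'a triple \<times> bool) pre_digraph" where
  "Upsilon R =
    \<lparr>verts = triple_words R \<union> inv_word ` triple_words R,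
     arcs = R \<times> UNIV,
     tail = (\<lambda>((x, y, z), b). if b then x else inv_word z),
     head = (\<lambda>((x, y, z), b). if b then inv_word z else x)\<rparr>"

definition rep_word :: "'a triple set \<Rightarrow> 'a word \<Rightarrow> nat" where
  "rep_word R w = card {(u, m, v) \<in> R. m = w} + card {(u, m, v) \<in> R. m = inv_word w}"

definition vertices_over :: "'a set \<Rightarrow> 'a word set \<Rightarrow> 'a triple set \<Rightarrow> 'a word set \<Rightarrow> 'a word set" where
  "vertices_over S T R g = {w \<in> verts (Upsilon R). word_img S T w = g}"

definition deg_elem :: "'a set \<Rightarrow> 'a word set \<Rightarrow> 'a triple set \<Rightarrow> 'a word set \<Rightarrow> nat" where
  "deg_elem S T R g = (\<Sum>w\<in>vertices_over S T R g. out_degree (Upsilon R) w)"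

definition rep_elem :: "'a set \<Rightarrow> 'a word set \<Rightarrow> 'a triple set \<Rightarrow> 'a word set \<Rightarrow> nat" where
  "rep_elem S T R g = (\<Sum>w\<in>vertices_over S T R g. rep_word R w)"

section \<open>Complex Hilbert spaces and Property (T)\<close>

class complex_vector = real_vector +
  fixes scaleC :: "complex \<Rightarrow> 'a \<Rightarrow> 'a"
  assumes scaleC_add_right: "scaleC c (x + y) = scaleC c x + scaleC c y"
    and scaleC_add_left: "scaleC (c + d) x = scaleC c x + scaleC d x"
    and scaleC_scaleC: "scaleC c (scaleC d x) = scaleC (c * d) x"
    and scaleC_of_real: "scaleC (complex_of_real r) x = scaleR r x"

class complex_inner = complex_vector + real_normed_vector +
  fixes cinner :: "'a \<Rightarrow> 'a \<Rightarrow> complex"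
  assumes cinner_commute: "cinner x y = cnj (cinner y x)"
    and cinner_add_left: "cinner (x + y) z = cinner x z + cinner y z"
    and cinner_scaleC_left: "cinner (scaleC c x) y = c * cinner x y"
    and cinner_self: "cinner x x = complex_of_real ((norm x)\<^sup>2)"

class complex_hilbert = complex_inner + complete_space

instantiation complex :: complex_hilbert
begin
definition scaleC_complex :: "complex \<Rightarrow> complex \<Rightarrow> complex" where
  "scaleC_complex c x = c * x"
definition cinner_complex :: "complex \<Rightarrow> complex \<Rightarrow> complex" where
  "cinner_complex x y = x * cnj y"
instance
proof
  fix c d x y z :: complex and r :: real
  show "scaleC c (x + y) = scaleC c x + scaleC c y"
    by (simp add: scaleC_complex_def distrib_left)
  show "scaleC (c + d) x = scaleC c x + scaleC d x"
    by (simp add: scaleC_complex_def distrib_right)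
  show "scaleC c (scaleC d x) = scaleC (c * d) x"
    by (simp add: scaleC_complex_def)
  show "scaleC (complex_of_real r) x = scaleR r x"
    by (simp add: scaleC_complex_def scaleR_conv_of_real)
  show "cinner x y = cnj (cinner y x)"
    by (simp add: cinner_complex_def)
  show "cinner (x + y) z = cinner x z + cinner y z"
    by (simp add: cinner_complex_def distrib_right)
  show "cinner (scaleC c x) y = c * cinner x y"
    by (simp add: cinner_complex_def scaleC_complex_def)
  show "cinner x x = complex_of_real ((norm x)\<^sup>2)"
    by (simp only: cinner_complex_def complex_norm_square)
qed
end

definition unitary :: "('h::complex_hilbert \<Rightarrow> 'h) \<Rightarrow> bool" where
  "unitary U \<longleftrightarrow> (\<forall>x y. U (x + y) = U x + U y) \<and> (\<forall>c x. U (scaleC c x) = scaleC c (U x)) \<and>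
     (\<forall>x y. cinner (U x) (U y) = cinner x y) \<and> surj U"

definition unitary_rep :: "('g, 'm) monoid_scheme \<Rightarrow> ('g \<Rightarrow> 'h::complex_hilbert \<Rightarrow> 'h) \<Rightarrow> bool" where
  "unitary_rep \<Gamma> \<pi> \<longleftrightarrow> (\<forall>g\<in>carrier \<Gamma>. unitary (\<pi> g)) \<and>
     (\<forall>g\<in>carrier \<Gamma>. \<forall>h\<in>carrier \<Gamma>. \<pi> (g \<otimes>\<^bsub>\<Gamma>\<^esub> h) = \<pi> g \<circ> \<pi> h)"

definition almost_invariant_vectors :: "'g set \<Rightarrow> ('g \<Rightarrow> 'h::complex_hilbert \<Rightarrow> 'h) \<Rightarrow> bool" where
  "almost_invariant_vectors A \<pi> \<longleftrightarrow>
     (\<forall>\<eta>>0. \<exists>u. u \<noteq> 0 \<and> (\<forall>a\<in>A. norm (\<pi> a u - u) < \<eta> * norm u))"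

definition has_invariant_vector ::
    "('g, 'm) monoid_scheme \<Rightarrow> ('g \<Rightarrow> 'h::complex_hilbert \<Rightarrow> 'h) \<Rightarrow> bool" where
  "has_invariant_vector \<Gamma> \<pi> \<longleftrightarrow> (\<exists>u. u \<noteq> 0 \<and> (\<forall>g\<in>carrier \<Gamma>. \<pi> g u = u))"

definition finite_generating_set :: "('g, 'm) monoid_scheme \<Rightarrow> 'g set \<Rightarrow> bool" where
  "finite_generating_set \<Gamma> A \<longleftrightarrow> finite A \<and> A \<subseteq> carrier \<Gamma> \<and> generate \<Gamma> A = carrier \<Gamma>"

text \<open>HOL cannot quantify over types inside a formula, so the type of the Hilbert space is a
  parameter. A theorem concluding \<open>property_T TYPE('h) \<Gamma>\<close> for a type variable \<open>'h\<close> covers every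
  Hilbert space. The property does not depend on the finite generating set; it is required for
  all of them.\<close>

definition property_T :: "'h::complex_hilbert itself \<Rightarrow> ('g, 'm) monoid_scheme \<Rightarrow> bool" where
  "property_T _ \<Gamma> \<longleftrightarrow> group \<Gamma> \<and> (\<exists>A. finite_generating_set \<Gamma> A) \<and>
     (\<forall>A. finite_generating_set \<Gamma> A \<longrightarrow>
        (\<forall>\<pi> :: 'g \<Rightarrow> 'h \<Rightarrow> 'h. unitary_rep \<Gamma> \<pi> \<longrightarrow> almost_invariant_vectors A \<pi> \<longrightarrow>
           has_invariant_vector \<Gamma> \<pi>))"

end

theory Submission
  imports
    Defs
    "HOL-Analysis.Convex"
    "Jordan_Normal_Form.Spectral_Radius"
begin

text \<open>
  Let \<open>U\<close> be a unitary representation of the quotient, lifted to \<open>G\<close>, let \<open>d(g)\<close> be the degree, \<open>N\<close> its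
  sum, and \<open>\<Delta>\<close> the Laplacian \<open>u \<mapsto> N\<^sup>-\<^sup>1 \<Sum> w(g) (u - U(g) u)\<close> with the symmetrised weights
  \<open>w(g) = (d(g) + d(g\<^sup>-\<^sup>1)) / 2\<close>. As \<open>x y z\<close> acts trivially, the function \<open>f(v) = U(v) u - u\<close> on the vertices
  has \<open>\<parallel>f(x) - f(z\<^sup>-\<^sup>1)\<parallel> = \<parallel>f(y)\<parallel>\<close>. Hence the Dirichlet form of \<open>f\<close> is controlled by \<open>rep\<close>, and the
  Poincare inequality for \<open>\<lambda>\<^sub>1\<close> bounds the energy \<open>E(u) = \<Sum> d(g) \<parallel>U(g) u - u\<parallel>\<^sup>2 = 2 N \<langle>\<Delta> u, u\<rangle>\<close> by the
  norm of the mean of \<open>f\<close>. That mean is \<open>- \<Delta> u\<close> up to an error of size \<open>\<epsilon>/2 (E(u) / N)\<^bsup>1/2\<^esup>\<close> coming from the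
  asymmetry of \<open>d\<close>, so \<open>\<kappa> \<langle>\<Delta> u, u\<rangle> \<le> \<parallel>\<Delta> u\<parallel>\<^sup>2\<close> with \<open>\<kappa> > 0\<close> independent of \<open>u\<close>. Under such an inequality
  the iterates of \<open>1 - \<Delta>/2\<close> converge geometrically, and the limit is a vector in the kernel of
  \<open>\<Delta>\<close>, that is, invariant under \<open>\<W>(R)\<close>, at distance \<open>O(E(u)\<^bsup>1/2\<^esup>)\<close> from \<open>u\<close>. For a sufficiently invariant \<open>u\<close> the
  average of this vector over the finitely many cosets of \<open>\<langle>\<W>(R)\<rangle>\<close> is non-zero, and it is invariant.
\<close>

unbundle no inner_syntax

section \<open>Diagonalisation of real symmetric matrices\<close>

text \<open>The reflection in the hyperplane orthogonal to the difference of two unit vectors swaps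
  them. Being its own inverse and transpose, it replaces the completion of \<open>v\<close> to an
  orthonormal basis.\<close>

lemma householder:
  fixes v :: "real vec"
  assumes v: "v \<in> carrier_vec n" and n: "0 < n" and unit: "v \<bullet> v = 1"
  obtains W :: "real mat" where "W \<in> carrier_mat n n" "W\<^sup>T = W" "W * W = 1\<^sub>m n" "col W 0 = v"
proof -
  define u where "u i = v $ i - (if i = 0 then 1 else 0)" for i
  define s where "s = (\<Sum>k<n. u k * u k)"
  define c where "c = 2 / s"
  \<comment> \<open>the reflection that exchanges \<open>v\<close> and the first unit vector; for \<open>u = 0\<close>, division by zero
    gives \<open>c = 0\<close> and the identity\<close>
  define W where "W = mat n n (\<lambda>(i, j). (if i = j then 1 else 0) - c * u i * u j)"
  have W: "W \<in> carrier_mat n n" by (simp add: W_def)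
  have sym: "W\<^sup>T = W" by (rule eq_matI) (auto simp: W_def)
  \<comment> \<open>Valid for \<open>s = 0\<close> as well, since then \<open>c = 0\<close>; this
    identity makes the reflection an involution.\<close>
  have cs: "c * c * s = 2 * c" by (simp add: c_def)
  have vv: "(\<Sum>k<n. v $ k * v $ k) = 1"
    using unit v by (simp add: scalar_prod_def atLeast0LessThan)
  have "s = (\<Sum>k<n. v $ k * v $ k - 2 * (if k = 0 then v $ 0 else 0) + (if k = 0 then 1 else 0))"
    unfolding s_def u_def by (intro sum.cong) (auto simp: algebra_simps)
  also have "\<dots> = 2 - 2 * v $ 0"
    using n vv by (simp add: sum.distrib sum_subtractf flip: sum_distrib_left)
  finally have s: "s = - 2 * u 0" by (simp add: u_def)
  \<comment> \<open>For \<open>s = 0\<close> every \<open>u i\<close> vanishes; otherwise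
    \<open>s = - 2 * u 0\<close> gives \<open>c * u 0 = - 1\<close>. Hence the first column is the
    first unit vector plus \<open>u\<close>, which is \<open>v\<close>.\<close>
  have cu: "c * u i * u 0 = - u i" if "i < n" for i
  proof (cases "s = 0")
    case True
    then have "u i * u i = 0"
      using that unfolding s_def by (subst (asm) sum_nonneg_eq_0_iff) auto
    then show ?thesis by simp
  next
    case False
    then show ?thesis by (simp add: c_def s field_simps)
  qed
  have inv: "W * W = 1\<^sub>m n"
  proof (rule eq_matI)
    fix i j assume "i < dim_row (1\<^sub>m n :: real mat)" "j < dim_col (1\<^sub>m n :: real mat)"
    then have ij: "i < n" "j < n" by auto
    have "(W * W) $$ (i, j) = (\<Sum>k<n. ((if i = k then 1 else 0) - c * u i * u k) *
        ((if k = j then 1 else 0) - c * u k * u j))"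
      using ij by (simp add: W_def scalar_prod_def atLeast0LessThan)
    also have "\<dots> = (\<Sum>k<n. (if i = k then if k = j then 1 else 0 else 0) -
        (if k = j then c * u i * u j else 0) - (if i = k then c * u i * u j else 0) +
        (c * c * u i * u j) * (u k * u k))"
      by (intro sum.cong) (auto simp: algebra_simps)
    also have "\<dots> = (if i = j then 1 else 0) - 2 * c * u i * u j + c * c * s * u i * u j"
      using ij unfolding s_def sum.distrib sum_subtractf sum_distrib_left[symmetric]
      by (simp add: mult.commute mult.left_commute)
    also have "\<dots> = 1\<^sub>m n $$ (i, j)" using ij by (simp add: cs)
    finally show "(W * W) $$ (i, j) = 1\<^sub>m n $$ (i, j)" .
  qed (use W in auto)
  have "col W 0 = v"
  proof (rule eq_vecI)
    fix i assume "i < dim_vec v"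
    then show "col W 0 $ i = v $ i" using n v cu[of i] by (auto simp: W_def u_def)
  qed (use W v in auto)
  with W sym inv show ?thesis by (rule that)
qed

text \<open>Over the complex numbers an eigenvector \<open>z\<close> exists. By symmetry the form
  \<open>q\<close> at \<open>z\<close> is real, and so is the squared length \<open>m\<close>, which
  is non-zero; hence the eigenvalue \<open>q / m\<close> is real.\<close>

lemma real_symmetric_unit_eigenvector:
  fixes A :: "real mat"
  assumes A: "A \<in> carrier_mat n n" and sym: "A\<^sup>T = A" and n: "0 < n"
  obtains v e where "v \<in> carrier_vec n" "v \<bullet> v = 1" "A *\<^sub>v v = e \<cdot>\<^sub>v v"
proof -
  define B where "B = map_mat complex_of_real A"
  have B: "B \<in> carrier_mat n n" using A by (simp add: B_def)
  obtain a where "a \<in> spectrum B" using spectrum_non_empty[OF B n] by blast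
  then obtain z where z: "z \<in> carrier_vec n" "z \<noteq> 0\<^sub>v n" "B *\<^sub>v z = a \<cdot>\<^sub>v z"
    using B by (auto simp: spectrum_def eigenvalue_def eigenvector_def)
  have Aij: "A $$ (i, j) = A $$ (j, i)" if "i < n" "j < n" for i j
    using that A sym by (metis carrier_matD index_transpose_mat(1))
  have Bz: "(\<Sum>j<n. of_real (A $$ (i, j)) * z $ j) = a * z $ i" if "i < n" for i
  proof -
    have "(B *\<^sub>v z) $ i = (\<Sum>j<n. of_real (A $$ (i, j)) * z $ j)"
      using that A z(1) by (simp add: B_def scalar_prod_def atLeast0LessThan)
    then show ?thesis using z that by simp
  qed
  define q where "q = (\<Sum>i<n. \<Sum>j<n. cnj (z $ i) * of_real (A $$ (i, j)) * z $ j)"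
  define m where "m = (\<Sum>i<n. cnj (z $ i) * z $ i)"
  have qa: "q = a * m"
    unfolding q_def m_def sum_distrib_left
  proof (rule sum.cong[OF HOL.refl])
    fix i assume "i \<in> {..<n}"
    then show "(\<Sum>j<n. cnj (z $ i) * of_real (A $$ (i, j)) * z $ j) = a * (cnj (z $ i) * z $ i)"
      using Bz[of i] by (simp add: mult.assoc mult.left_commute flip: sum_distrib_left)
  qed
  have "cnj q = (\<Sum>i<n. \<Sum>j<n. z $ i * of_real (A $$ (i, j)) * cnj (z $ j))"
    by (simp add: q_def)
  also have "\<dots> = (\<Sum>j<n. \<Sum>i<n. z $ i * of_real (A $$ (i, j)) * cnj (z $ j))"
    by (rule sum.swap)
  also have "\<dots> = q" unfolding q_def
    by (intro sum.cong HOL.refl) (simp add: Aij mult.commute mult.left_commute)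
  finally have "cnj q = q" .
  have "cnj m = m" by (simp add: m_def mult.commute)
  have m0: "m \<noteq> 0"
  proof
    assume "m = 0"
    moreover have "m = of_real (\<Sum>i<n. (cmod (z $ i))\<^sup>2)"
      unfolding m_def of_real_sum
      by (intro sum.cong HOL.refl) (simp add: complex_norm_square mult.commute del: of_real_power)
    ultimately have "(\<Sum>i<n. (cmod (z $ i))\<^sup>2) = 0" by (metis of_real_eq_0_iff)
    then have "\<forall>i<n. z $ i = 0" by (subst (asm) sum_nonneg_eq_0_iff) auto
    with z(1,2) show False by auto
  qed
  have "cnj a = a"
    using \<open>cnj q = q\<close> \<open>cnj m = m\<close> qa m0 by (metis complex_cnj_mult mult_cancel_right)
  then obtain e where e: "a = of_real e" by (metis Reals_cases complex_is_Real_iff Reals_cnj_iff)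
  \<comment> \<open>The real eigenvalue, not the complex eigenvector, is carried back to
    \<open>A\<close>: it is a root of the common characteristic polynomial, so a real eigenvector
    belongs to it.\<close>
  have "poly (char_poly B) (of_real e) = 0"
    using z B e by (auto simp: eigenvalue_root_char_poly[OF B, symmetric] eigenvalue_def eigenvector_def)
  then have "poly (char_poly A) e = 0"
    unfolding B_def of_real_hom.char_poly_hom[OF A] by simp
  then have "eigenvalue A e" using eigenvalue_root_char_poly[OF A] by simp
  then obtain w where w: "w \<in> carrier_vec n" "w \<noteq> 0\<^sub>v n" "A *\<^sub>v w = e \<cdot>\<^sub>v w"
    using A by (auto simp: eigenvalue_def eigenvector_def)
  have pos: "0 < w \<bullet> w"
  proof -
    have "w \<bullet> w = (\<Sum>i<n. (w $ i)\<^sup>2)"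
      using w(1) by (simp add: scalar_prod_def atLeast0LessThan power2_eq_square)
    moreover have "\<dots> \<noteq> 0"
    proof
      assume "(\<Sum>i<n. (w $ i)\<^sup>2) = 0"
      then have "\<forall>i<n. w $ i = 0" by (subst (asm) sum_nonneg_eq_0_iff) auto
      with w(1,2) show False by auto
    qed
    ultimately show ?thesis by (metis sum_nonneg zero_le_power2 less_eq_real_def)
  qed
  define v where "v = (1 / sqrt (w \<bullet> w)) \<cdot>\<^sub>v w"
  show ?thesis
  proof (rule that)
    show v: "v \<in> carrier_vec n" using w by (simp add: v_def)
    show "v \<bullet> v = 1"
      using w(1) pos by (simp add: v_def field_simps)
    show "A *\<^sub>v v = e \<cdot>\<^sub>v v"
      using w A by (simp add: v_def mult_mat_vec smult_smult_assoc mult.commute)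
  qed
qed

text \<open>Induction on the size: conjugation by a reflection whose first column is a unit
  eigenvector splits off a block of size 1, and the remaining block is again symmetric.\<close>

lemma real_symmetric_diagonalisation:
  fixes A :: "real mat"
  assumes "A \<in> carrier_mat n n" "A\<^sup>T = A"
  shows "\<exists>P D. P \<in> carrier_mat n n \<and> D \<in> carrier_mat n n \<and> diagonal_mat D \<and>
    P\<^sup>T * P = 1\<^sub>m n \<and> A = P * D * P\<^sup>T"
  using assms
proof (induction n arbitrary: A)
  case 0
  then show ?case
    by (intro exI[of _ "1\<^sub>m 0"] exI[of _ A]) (auto simp: diagonal_mat_def)
next
  case (Suc n)
  note A = Suc.prems(1)
  obtain v e where v: "v \<in> carrier_vec (Suc n)" "v \<bullet> v = 1" "A *\<^sub>v v = e \<cdot>\<^sub>v v"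
    using real_symmetric_unit_eigenvector[OF Suc.prems] by blast
  obtain W where W: "W \<in> carrier_mat (Suc n) (Suc n)" "W\<^sup>T = W" "W * W = 1\<^sub>m (Suc n)" "col W 0 = v"
    using householder[OF v(1) _ v(2)] by blast
  define B where "B = W * A * W"
  have B: "B \<in> carrier_mat (Suc n) (Suc n)" using W(1) A by (simp add: B_def)
  have AB: "A = W * B * W"
  proof -
    have "W * B * W = (W * W) * A * (W * W)"
      using W(1) A by (simp add: B_def assoc_mult_mat[of _ "Suc n" "Suc n" _ "Suc n" _ "Suc n"])
    then show ?thesis using A W(3) by simp
  qed
  have Bsym: "B\<^sup>T = B"
    using W(1,2) A Suc.prems(2)
    by (simp add: B_def transpose_mult[of _ "Suc n" "Suc n" _ "Suc n"]
        assoc_mult_mat[of _ "Suc n" "Suc n" _ "Suc n" _ "Suc n"])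
  \<comment> \<open>The first column of \<open>B\<close> is \<open>W * A\<close> applied to
    \<open>v\<close>, hence \<open>e\<close> times \<open>W\<close> applied to \<open>v\<close>; the
    latter is the first unit vector because \<open>v\<close> is the first column of the involution
    \<open>W\<close>.\<close>
  have "B = W * (A * W)"
    using W A by (simp add: B_def assoc_mult_mat[of _ "Suc n" "Suc n" _ "Suc n" _ "Suc n"])
  then have "col B 0 = W *\<^sub>v col (A * W) 0"
    using W A by (simp only: col_mult2[of _ "Suc n" "Suc n" _ "Suc n"] mult_carrier_mat[of A "Suc n" "Suc n"] zero_less_Suc)
  also have "col (A * W) 0 = A *\<^sub>v v"
    using W A by (simp only: col_mult2[of _ "Suc n" "Suc n" _ "Suc n"] zero_less_Suc)
  finally have "col B 0 = W *\<^sub>v (A *\<^sub>v v)" .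
  also have "\<dots> = e \<cdot>\<^sub>v (W *\<^sub>v col W 0)"
    using v W by (simp add: mult_mat_vec)
  also have "W *\<^sub>v col W 0 = col (1\<^sub>m (Suc n)) 0"
    using col_mult2[OF W(1,1), of 0] W(3) by simp
  finally have col0: "col B 0 = e \<cdot>\<^sub>v unit_vec (Suc n) 0" by simp
  have B0: "B $$ (i, 0) = (if i = 0 then e else 0)" if "i < Suc n" for i
    using arg_cong[OF col0, of "\<lambda>x. x $ i"] that B by (simp add: unit_vec_def)
  have Bij: "B $$ (i, j) = B $$ (j, i)" if "i < Suc n" "j < Suc n" for i j
    using that B Bsym by (metis carrier_matD index_transpose_mat(1))
  define A' where "A' = mat n n (\<lambda>(i, j). B $$ (Suc i, Suc j))"
  have A': "A' \<in> carrier_mat n n" by (simp add: A'_def)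
  define E where "E = mat 1 1 (\<lambda>_. e)"
  have E: "E \<in> carrier_mat 1 1" by (simp add: E_def)
  \<comment> \<open>The first row is determined by the first column through the symmetry of
    \<open>B\<close>.\<close>
  have Bblock: "B = four_block_mat E (0\<^sub>m 1 n) (0\<^sub>m n 1) A'"
  proof (rule eq_matI)
    fix i j
    assume "i < dim_row (four_block_mat E (0\<^sub>m 1 n) (0\<^sub>m n 1) A')"
      "j < dim_col (four_block_mat E (0\<^sub>m 1 n) (0\<^sub>m n 1) A')"
    then have "i < Suc n" "j < Suc n" using A' E by auto
    then show "B $$ (i, j) = four_block_mat E (0\<^sub>m 1 n) (0\<^sub>m n 1) A' $$ (i, j)"
      using B0[of i] B0[of j] Bij[of i j] A' E
      by (cases i; cases j) (auto simp: A'_def E_def)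
  qed (use A' E B in auto)
  have "A'\<^sup>T = A'" by (rule eq_matI) (auto simp: A'_def Bij)
  from Suc.IH[OF A' this] obtain P D where
    P: "P \<in> carrier_mat n n" and D: "D \<in> carrier_mat n n" and diag: "diagonal_mat D"
    and orth: "P\<^sup>T * P = 1\<^sub>m n" and A'_eq: "A' = P * D * P\<^sup>T" by blast
  define P1 where "P1 = four_block_mat (1\<^sub>m 1) (0\<^sub>m 1 n) (0\<^sub>m n 1) P"
  define D1 where "D1 = four_block_mat E (0\<^sub>m 1 n) (0\<^sub>m n 1) D"
  have P1: "P1 \<in> carrier_mat (Suc n) (Suc n)" using P by (auto simp: P1_def)
  have D1: "D1 \<in> carrier_mat (Suc n) (Suc n)" using D E by (auto simp: D1_def)
  have P1T: "P1\<^sup>T = four_block_mat (1\<^sub>m 1) (0\<^sub>m 1 n) (0\<^sub>m n 1) (P\<^sup>T)"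
    unfolding P1_def using P by (subst transpose_four_block_mat[of _ 1 1 _ n _ n]) auto
  have orth1: "P1\<^sup>T * P1 = 1\<^sub>m (Suc n)"
    unfolding P1T unfolding P1_def using P orth
    by (subst mult_four_block_mat[of _ 1 1 _ n _ n _ _ 1 _ n]) (auto intro!: eq_matI)
  have PD: "P1 * D1 * P1\<^sup>T = B"
    unfolding P1T unfolding P1_def D1_def Bblock A'_eq using P D E
    by (subst mult_four_block_mat[of _ 1 1 _ n _ n _ _ 1 _ n], auto)
      (subst mult_four_block_mat[of _ 1 1 _ n _ n _ _ 1 _ n], auto)
  have dD1: "diagonal_mat D1"
    using diag D E by (auto simp: diagonal_mat_def D1_def)
  have "(W * P1)\<^sup>T = P1\<^sup>T * W"
    using transpose_mult[OF W(1) P1] W(2) by simp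
  moreover have "P1\<^sup>T * W * (W * P1) = P1\<^sup>T * (W * W) * P1"
    using W(1) P1 by (simp add: assoc_mult_mat[of _ "Suc n" "Suc n" _ "Suc n" _ "Suc n"])
  moreover have "W * P1 * D1 * (P1\<^sup>T * W) = W * (P1 * D1 * P1\<^sup>T) * W"
    using W(1) P1 D1 by (simp add: assoc_mult_mat[of _ "Suc n" "Suc n" _ "Suc n" _ "Suc n"])
  ultimately show ?case
    using W P1 D1 dD1 orth1 PD AB
    by (intro exI[of _ "W * P1"] exI[of _ D1]) simp
qed

text \<open>Similar matrices share their characteristic polynomial, and that of a diagonal matrix
  splits. This turns the sorted roots in \<open>lambda1\<close> into sorted diagonal
  entries.\<close>

lemma proots_char_poly_diagonalisation:
  fixes A :: "real mat"
  assumes P: "P \<in> carrier_mat n n" and D: "D \<in> carrier_mat n n" and diag: "diagonal_mat D"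
    and orth: "P\<^sup>T * P = 1\<^sub>m n" and A: "A = P * D * P\<^sup>T"
  shows "proots (char_poly A) = mset (diag_mat D)"
proof -
  have "P * P\<^sup>T = 1\<^sub>m n" using mat_mult_left_right_inverse[of "P\<^sup>T" n P] P orth by simp
  then have "similar_mat A D"
    unfolding similar_mat_def
    using P D A orth by (intro exI[of _ P] exI[of _ "P\<^sup>T"] similar_mat_witI[of _ _ n]) auto
  then have "char_poly A = char_poly D" by (rule char_poly_similar)
  also have "\<dots> = (\<Prod>a\<leftarrow>diag_mat D. [:- a, 1:])"
    using D diag by (intro char_poly_upper_triangular[of _ n]) (auto simp: diagonal_mat_def)
  also have "proots (\<Prod>a\<leftarrow>xs. [:- a, 1:]) = mset xs" for xs :: "real list"
  proof (induction xs)
    case (Cons a xs)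
    have "(\<Prod>a\<leftarrow>xs. [:- a, 1:]) \<noteq> (0 :: real poly)" by (auto simp: prod_list_zero_iff)
    then have "proots ([:- a, 1:] * (\<Prod>a\<leftarrow>xs. [:- a, 1:])) =
        proots [:- a, 1:] + proots (\<Prod>a\<leftarrow>xs. [:- a, 1:])"
      by (intro proots_mult) auto
    also have "proots [:- a, 1:] = {#a#}" by (subst proots_linear_factor) simp
    finally show ?case using Cons.IH by simp
  qed simp
  finally show ?thesis .
qed

section \<open>The second smallest eigenvalue\<close>

text \<open>The real part induces the same norm, so energies and quadratic forms can be handled over
  the reals.\<close>

definition rinner :: "'h::complex_inner \<Rightarrow> 'h \<Rightarrow> real" where
  "rinner x y = Re (cinner x y)"

lemma rinner_self: "rinner x x = (norm x)\<^sup>2"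
  unfolding rinner_def cinner_self by simp

lemma rinner_commute: "rinner x y = rinner y x"
  unfolding rinner_def by (subst cinner_commute) simp

lemma rinner_add_left: "rinner (x + y) z = rinner x z + rinner y z"
  by (simp add: rinner_def cinner_add_left)

lemma rinner_add_right: "rinner x (y + z) = rinner x y + rinner x z"
  using rinner_add_left[of y z x] rinner_commute[of x] by simp

lemma rinner_scaleR_left: "rinner (r *\<^sub>R x) y = r * rinner x y"
  unfolding rinner_def scaleC_of_real[symmetric] cinner_scaleC_left by simp

lemma norm_add_rinner: "(norm (x + y))\<^sup>2 = (norm x)\<^sup>2 + 2 * rinner x y + (norm y)\<^sup>2"
proof -
  have "rinner (x + y) (x + y) = rinner x x + rinner y x + (rinner x y + rinner y y)"
    by (simp only: rinner_add_left rinner_add_right)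
  then show ?thesis using rinner_commute[of y x] by (simp add: rinner_self)
qed

text \<open>Cauchy-Schwarz, read off from the triangle inequality, which is an axiom for the norm of
  the class.\<close>

lemma rinner_le_norm: "rinner x y \<le> norm x * norm y"
proof -
  have "(norm (x + y))\<^sup>2 \<le> (norm x + norm y)\<^sup>2"
    by (intro power_mono norm_triangle_ineq norm_ge_zero)
  then show ?thesis unfolding norm_add_rinner by (simp add: power2_sum)
qed

lemma abs_rinner_le_norm: "\<bar>rinner x y\<bar> \<le> norm x * norm y"
  using rinner_le_norm[of x y] rinner_le_norm[of "-x" y] rinner_scaleR_left[of "-1" x y] by simp

interpretation rinner: bounded_bilinear "rinner :: 'h::complex_inner \<Rightarrow> 'h \<Rightarrow> real"
proof
  fix a a' b b' :: 'h and r :: real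
  show "rinner (a + a') b = rinner a b + rinner a' b" by (rule rinner_add_left)
  show "rinner a (b + b') = rinner a b + rinner a b'"
    by (rule rinner_add_right)
  show "rinner (r *\<^sub>R a) b = r *\<^sub>R rinner a b" by (simp add: rinner_scaleR_left)
  show "rinner a (r *\<^sub>R b) = r *\<^sub>R rinner a b"
    using rinner_scaleR_left[of r b a] rinner_commute[of a] by simp
  show "\<exists>K. \<forall>a b :: 'h. norm (rinner a b) \<le> norm a * norm b * K"
    using abs_rinner_le_norm by (intro exI[of _ 1]) auto
qed

lemma norm_diff_rinner: "(norm (x - y))\<^sup>2 = (norm x)\<^sup>2 - 2 * rinner x y + (norm y)\<^sup>2"
  using norm_add_rinner[of x "- y"] by (simp add: rinner.minus_right)

text \<open>As the second entry is positive, the value 0 at \<open>k0\<close> can only be the first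
  entry of the list. All other indices then account for the remaining entries.\<close>

lemma sorted_second_le:
  fixes d :: "nat \<Rightarrow> real"
  assumes xs: "xs = sorted_list_of_multiset (mset (map d [0..<n]))"
    and pos: "0 < xs ! 1" and k0: "k0 < n" "d k0 = 0" and k: "k < n" "k \<noteq> k0"
  shows "xs ! 1 \<le> d k"
proof -
  have srt: "sorted xs" by (simp add: xs)
  have mset: "mset xs = image_mset d (mset_set {0..<n})" by (simp add: xs)
  then have len: "length xs = n" by (metis size_image_mset size_mset size_mset_set card_atLeastLessThan diff_zero)
  have "2 \<le> n" using k0(1) k by linarith
  then obtain x y ys where xs': "xs = x # y # ys"
    using len by (cases xs; cases "tl xs") auto
  have ge: "xs ! 1 \<le> z" if "z \<in> set (y # ys)" for z using that srt by (auto simp: xs')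
  have split: "mset xs = add_mset (d k0) (image_mset d (mset_set ({0..<n} - {k0})))"
    unfolding mset using k0(1) by (subst mset_set.remove[of _ k0]) auto
  then have "d k0 \<in># mset xs" by simp
  then have "d k0 \<in> set xs" by simp
  then have "x = d k0" using ge pos k0(2) by (fastforce simp: xs')
  then have "mset (y # ys) = image_mset d (mset_set ({0..<n} - {k0}))"
    using split by (simp add: xs')
  then have "d k \<in># mset (y # ys)" using k by simp
  then show ?thesis using ge by simp
qed

text \<open>A variational bound for vector-valued functions. In an eigenbasis the form is a sum of
  eigenvalues times squared norms of coefficients; since \<open>\<mu>\<close> is positive, the
  kernel is the line of \<open>s\<close>, and the subtracted term is exactly the component along
  it.\<close>

lemma symmetric_form_ge_second_eigenvalue:
  fixes A :: "real mat" and F :: "nat \<Rightarrow> 'h::complex_inner"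
  assumes A: "A \<in> carrier_mat n n" and sym: "A\<^sup>T = A"
    and ev: "\<mu> = sorted_list_of_multiset (proots (char_poly A)) ! 1" and pos: "0 < \<mu>"
    and ker: "\<And>i. i < n \<Longrightarrow> (\<Sum>j<n. A $$ (i, j) * s j) = 0"
    and N: "N = (\<Sum>i<n. (s i)\<^sup>2)" "0 < N"
  shows "\<mu> * ((\<Sum>i<n. (norm (F i))\<^sup>2) - (norm (\<Sum>i<n. s i *\<^sub>R F i))\<^sup>2 / N)
    \<le> (\<Sum>i<n. \<Sum>j<n. A $$ (i, j) * rinner (F i) (F j))"
proof -
  obtain P D where P: "P \<in> carrier_mat n n" and D: "D \<in> carrier_mat n n" and diag: "diagonal_mat D"
    and orth: "P\<^sup>T * P = 1\<^sub>m n" and A_eq: "A = P * D * P\<^sup>T"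
    using real_symmetric_diagonalisation[OF A sym] by blast
  define d where "d k = D $$ (k, k)" for k
  define p where "p k i = P $$ (i, k)" for k i
  have PPT: "P * P\<^sup>T = 1\<^sub>m n" using mat_mult_left_right_inverse[of "P\<^sup>T" n P] P orth by simp
  have complete: "(\<Sum>k<n. p k i * p k j) = (if i = j then 1 else 0)" if "i < n" "j < n" for i j
    using arg_cong[OF PPT, of "\<lambda>M. M $$ (i, j)"] that P
    by (simp add: p_def scalar_prod_def atLeast0LessThan)
  have Aij: "A $$ (i, j) = (\<Sum>k<n. d k * (p k i * p k j))" if "i < n" "j < n" for i j
  proof -
    have PD: "(P * D) $$ (i, k) = p k i * d k" if "k < n" for k
    proof -
      have "(P * D) $$ (i, k) = (\<Sum>l<n. P $$ (i, l) * D $$ (l, k))"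
        using P D that \<open>i < n\<close> by (simp add: scalar_prod_def atLeast0LessThan)
      also have "\<dots> = (\<Sum>l<n. if l = k then P $$ (i, k) * D $$ (k, k) else 0)"
        using diag D that by (intro sum.cong) (auto simp: diagonal_mat_def)
      finally show ?thesis using that by (simp add: p_def d_def)
    qed
    obtain Q where Q: "Q = P * D" "Q \<in> carrier_mat n n" using P D by auto
    have "A $$ (i, j) = (\<Sum>k<n. Q $$ (i, k) * P $$ (j, k))"
      unfolding A_eq Q(1)[symmetric] using P Q(2) that
      by (simp add: scalar_prod_def atLeast0LessThan)
    also have "\<dots> = (\<Sum>k<n. d k * (p k i * p k j))"
      by (intro sum.cong) (auto simp: Q(1) PD p_def)
    finally show ?thesis .
  qed
  define xs where "xs = sorted_list_of_multiset (mset (map d [0..<n]))"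
  have "diag_mat D = map d [0..<n]" using D by (simp add: diag_mat_def d_def[abs_def])
  then have mu: "\<mu> = xs ! 1"
    unfolding ev xs_def proots_char_poly_diagonalisation[OF P D diag orth A_eq] by simp
  \<comment> \<open>\<open>G k\<close> and \<open>\<sigma> k\<close> are the coefficients of
    \<open>F\<close> and of \<open>s\<close> along the \<open>k\<close>-th eigenvector.\<close>
  define G where "G k = (\<Sum>i<n. p k i *\<^sub>R F i)" for k
  define \<sigma> where "\<sigma> k = (\<Sum>i<n. p k i * s i)" for k
  have normG: "(norm (G k))\<^sup>2 = (\<Sum>i<n. \<Sum>j<n. p k i * p k j * rinner (F i) (F j))" for k
    unfolding G_def rinner_self[symmetric] rinner.sum_left[of _ "{..<n}"]
    by (simp add: rinner.sum_right rinner.scaleR_left rinner.scaleR_right sum_distrib_left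
        mult.commute mult.left_commute)
  have form: "(\<Sum>i<n. \<Sum>j<n. A $$ (i, j) * rinner (F i) (F j)) = (\<Sum>k<n. d k * (norm (G k))\<^sup>2)"
  proof -
    have "(\<Sum>k<n. d k * (norm (G k))\<^sup>2) =
        (\<Sum>k<n. \<Sum>i<n. \<Sum>j<n. d k * (p k i * p k j) * rinner (F i) (F j))"
      by (simp add: normG sum_distrib_left mult.assoc)
    also have "\<dots> = (\<Sum>i<n. \<Sum>k<n. \<Sum>j<n. d k * (p k i * p k j) * rinner (F i) (F j))"
      by (rule sum.swap)
    also have "\<dots> = (\<Sum>i<n. \<Sum>j<n. \<Sum>k<n. d k * (p k i * p k j) * rinner (F i) (F j))"
      by (intro sum.cong HOL.refl sum.swap)
    also have "\<dots> = (\<Sum>i<n. \<Sum>j<n. A $$ (i, j) * rinner (F i) (F j))"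
      by (intro sum.cong HOL.refl) (simp add: Aij sum_distrib_right)
    finally show ?thesis by simp
  qed
  have total: "(\<Sum>i<n. (norm (F i))\<^sup>2) = (\<Sum>k<n. (norm (G k))\<^sup>2)"
  proof -
    have "(\<Sum>k<n. (norm (G k))\<^sup>2) = (\<Sum>i<n. \<Sum>k<n. \<Sum>j<n. p k i * p k j * rinner (F i) (F j))"
      unfolding normG by (rule sum.swap)
    also have "\<dots> = (\<Sum>i<n. \<Sum>j<n. \<Sum>k<n. p k i * p k j * rinner (F i) (F j))"
      by (intro sum.cong HOL.refl sum.swap)
    also have "\<dots> = (\<Sum>i<n. \<Sum>j<n. if i = j then rinner (F i) (F j) else 0)"
      by (intro sum.cong HOL.refl) (simp add: complete flip: sum_distrib_right)
    finally show ?thesis by (simp add: rinner_self)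
  qed
  have expand: "s i = (\<Sum>k<n. \<sigma> k * p k i)" if "i < n" for i
  proof -
    have "(\<Sum>k<n. \<sigma> k * p k i) = (\<Sum>k<n. \<Sum>j<n. s j * (p k i * p k j))"
      unfolding \<sigma>_def sum_distrib_right by (simp add: mult.commute mult.left_commute)
    also have "\<dots> = (\<Sum>j<n. \<Sum>k<n. s j * (p k i * p k j))" by (rule sum.swap)
    also have "\<dots> = (\<Sum>j<n. if j = i then s j else 0)"
      by (intro sum.cong HOL.refl) (use that in \<open>simp add: complete flip: sum_distrib_left\<close>)
    finally show ?thesis using that by simp
  qed
  have orthonormal: "(\<Sum>i<n. p k i * p l i) = (if k = l then 1 else 0)" if "k < n" "l < n" for k l
    using arg_cong[OF orth, of "\<lambda>M. M $$ (k, l)"] that P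
    by (simp add: p_def scalar_prod_def atLeast0LessThan)
  \<comment> \<open>The coefficient of \<open>A\<close> applied to \<open>s\<close> along the
    \<open>k\<close>-th eigenvector is \<open>d k * \<sigma> k\<close>, and \<open>s\<close> lies in
    the kernel.\<close>
  have ds: "d k * \<sigma> k = 0" if k: "k < n" for k
  proof -
    have "0 = (\<Sum>i<n. p k i * (\<Sum>j<n. A $$ (i, j) * s j))" by (simp add: ker)
    also have "\<dots> = (\<Sum>i<n. p k i * (\<Sum>l<n. d l * \<sigma> l * p l i))"
    proof (rule sum.cong[OF HOL.refl])
      fix i assume "i \<in> {..<n}"
      then have "(\<Sum>j<n. A $$ (i, j) * s j) = (\<Sum>j<n. \<Sum>l<n. d l * (p l i * p l j) * s j)"
        by (intro sum.cong) (auto simp: Aij sum_distrib_right)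
      also have "\<dots> = (\<Sum>l<n. \<Sum>j<n. d l * (p l i * p l j) * s j)" by (rule sum.swap)
      also have "\<dots> = (\<Sum>l<n. d l * \<sigma> l * p l i)"
        unfolding \<sigma>_def sum_distrib_left sum_distrib_right
        by (simp add: mult.commute mult.left_commute)
      finally show "p k i * (\<Sum>j<n. A $$ (i, j) * s j) = p k i * (\<Sum>l<n. d l * \<sigma> l * p l i)"
        by simp
    qed
    also have "\<dots> = (\<Sum>i<n. \<Sum>l<n. d l * \<sigma> l * (p k i * p l i))"
      unfolding sum_distrib_left by (simp add: mult.commute mult.left_commute)
    also have "\<dots> = (\<Sum>l<n. \<Sum>i<n. d l * \<sigma> l * (p k i * p l i))" by (rule sum.swap)
    also have "\<dots> = (\<Sum>l<n. if l = k then d l * \<sigma> l else 0)"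
      by (intro sum.cong HOL.refl) (use k in \<open>auto simp: orthonormal simp flip: sum_distrib_left\<close>)
    also have "\<dots> = d k * \<sigma> k" using k by simp
    finally show ?thesis by simp
  qed
  obtain k0 where k0: "k0 < n" "\<sigma> k0 \<noteq> 0"
  proof (rule ccontr)
    assume "\<not> thesis"
    with that have "\<forall>k<n. \<sigma> k = 0" by blast
    then have "\<forall>i<n. s i = 0" by (simp add: expand)
    with N show False by simp
  qed
  have d0: "d k0 = 0" using ds[OF k0(1)] k0(2) by simp
  have gap: "\<mu> \<le> d k" if "k < n" "k \<noteq> k0" for k
    using sorted_second_le[OF xs_def, of k0 k] pos mu k0(1) d0 that by simp
  \<comment> \<open>All eigenvalues other than \<open>d k0\<close> are at least
    \<open>\<mu> > 0\<close>, so \<open>s\<close> has no component there and is a multiple of one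
    unit eigenvector.\<close>
  have "\<sigma> k = 0" if "k < n" "k \<noteq> k0" for k using ds[OF that(1)] gap[OF that] pos by auto
  then have s: "s i = \<sigma> k0 * p k0 i" if "i < n" for i
    unfolding expand[OF that] using k0(1) by (subst sum.remove[of _ k0]) auto
  have "N = (\<Sum>i<n. (\<sigma> k0)\<^sup>2 * (p k0 i * p k0 i))"
    unfolding N by (intro sum.cong) (auto simp: s power2_eq_square)
  also have "\<dots> = (\<sigma> k0)\<^sup>2"
    using orthonormal[OF k0(1,1)] by (simp flip: sum_distrib_left)
  finally have N\<sigma>: "N = (\<sigma> k0)\<^sup>2" .
  have "(\<Sum>i<n. s i *\<^sub>R F i) = \<sigma> k0 *\<^sub>R G k0"
    unfolding G_def scaleR_sum_right by (intro sum.cong) (auto simp: s)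
  then have "(norm (\<Sum>i<n. s i *\<^sub>R F i))\<^sup>2 / N = (norm (G k0))\<^sup>2"
    using k0(2) by (simp add: N\<sigma> power_mult_distrib)
  then have "\<mu> * ((\<Sum>i<n. (norm (F i))\<^sup>2) - (norm (\<Sum>i<n. s i *\<^sub>R F i))\<^sup>2 / N) =
      (\<Sum>k\<in>{..<n} - {k0}. \<mu> * (norm (G k))\<^sup>2)"
    unfolding total using k0(1) by (subst sum.remove[of _ k0]) (auto simp: sum_distrib_left)
  also have "\<dots> \<le> (\<Sum>k\<in>{..<n} - {k0}. d k * (norm (G k))\<^sup>2)"
    by (intro sum_mono mult_right_mono) (auto simp: gap)
  also have "\<dots> = (\<Sum>k<n. d k * (norm (G k))\<^sup>2)"
    using k0(1) d0 by (subst sum.remove[of _ k0]) auto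
  finally show ?thesis unfolding form .
qed

section \<open>The Poincare inequality on a graph\<close>

lemma vertex_list:
  assumes "finite (verts \<Gamma>)"
  shows "distinct (vertex_list \<Gamma>)" "set (vertex_list \<Gamma>) = verts \<Gamma>"
proof -
  have "\<exists>vs. distinct vs \<and> set vs = verts \<Gamma>" using finite_distinct_list[OF assms] by blast
  then have "distinct (vertex_list \<Gamma>) \<and> set (vertex_list \<Gamma>) = verts \<Gamma>"
    unfolding vertex_list_def by (rule someI_ex)
  then show "distinct (vertex_list \<Gamma>)" "set (vertex_list \<Gamma>) = verts \<Gamma>" by auto
qed

lemma (in fin_digraph) sum_arcs_by_ends:
  fixes \<phi> :: "'a \<Rightarrow> 'a \<Rightarrow> real"
  shows "(\<Sum>u\<in>verts G. \<Sum>v\<in>verts G. real (card {e \<in> arcs G. tail G e = u \<and> head G e = v}) * \<phi> u v) =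
    (\<Sum>e\<in>arcs G. \<phi> (tail G e) (head G e))"
proof -
  have "(\<Sum>e\<in>arcs G. \<phi> (tail G e) (head G e)) =
      (\<Sum>y\<in>verts G \<times> verts G. \<Sum>e\<in>{e \<in> arcs G. (tail G e, head G e) = y}. \<phi> (tail G e) (head G e))"
    by (intro sum.group[symmetric]) auto
  also have "\<dots> = (\<Sum>(u, v)\<in>verts G \<times> verts G. real (card {e \<in> arcs G. tail G e = u \<and> head G e = v}) * \<phi> u v)"
    by (intro sum.cong) auto
  finally show ?thesis by (simp add: sum.cartesian_product)
qed

lemma (in fin_digraph) sum_arcs_by_tail:
  fixes \<psi> :: "'a \<Rightarrow> real"
  shows "(\<Sum>u\<in>verts G. real (out_degree G u) * \<psi> u) = (\<Sum>e\<in>arcs G. \<psi> (tail G e))"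
proof -
  have "(\<Sum>e\<in>arcs G. \<psi> (tail G e)) =
      (\<Sum>u\<in>verts G. \<Sum>e\<in>{e \<in> arcs G. tail G e = u}. \<psi> (tail G e))"
    by (intro sum.group[symmetric]) auto
  also have "\<dots> = (\<Sum>u\<in>verts G. real (out_degree G u) * \<psi> u)"
    by (intro sum.cong) (auto simp: out_degree_def out_arcs_def)
  finally show ?thesis by simp
qed

text \<open>The variational bound is applied to \<open>f\<close> scaled by the square roots
  \<open>s\<close> of the degrees. This \<open>s\<close> is the kernel vector of the normalised
  Laplacian, and its squared length is the total degree, that is, the number of arcs.\<close>

lemma poincare_inequality:
  fixes \<Gamma> :: "('v, 'e) pre_digraph" and f :: "'v \<Rightarrow> 'h::complex_inner"
  assumes fin: "fin_digraph \<Gamma>" and ne: "arcs \<Gamma> \<noteq> {}"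
    and sym: "\<And>u v. card {e \<in> arcs \<Gamma>. tail \<Gamma> e = u \<and> head \<Gamma> e = v} =
      card {e \<in> arcs \<Gamma>. tail \<Gamma> e = v \<and> head \<Gamma> e = u}"
    and pos: "0 < lambda1 \<Gamma>"
  shows "lambda1 \<Gamma> * ((\<Sum>v\<in>verts \<Gamma>. real (out_degree \<Gamma> v) * (norm (f v))\<^sup>2) -
      (norm (\<Sum>v\<in>verts \<Gamma>. real (out_degree \<Gamma> v) *\<^sub>R f v))\<^sup>2 / real (card (arcs \<Gamma>)))
    \<le> (\<Sum>e\<in>arcs \<Gamma>. (norm (f (tail \<Gamma> e) - f (head \<Gamma> e)))\<^sup>2) / 2"
proof -
  interpret fin_digraph \<Gamma> by fact
  define vs where "vs = vertex_list \<Gamma>"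
  define n where "n = length vs"
  have vs: "distinct vs" "set vs = verts \<Gamma>" using vertex_list[of \<Gamma>] by (auto simp: vs_def)
  have bij: "bij_betw ((!) vs) {..<n} (verts \<Gamma>)"
    using bij_betw_nth[OF vs(1)] vs(2) by (simp add: n_def)
  define a where "a u v = real (card {e \<in> arcs \<Gamma>. tail \<Gamma> e = u \<and> head \<Gamma> e = v})" for u v
  define s where "s v = sqrt (real (out_degree \<Gamma> v))" for v
  define Lp where "Lp u v = (if u = v then 1 else 0) - a u v / (s u * s v)" for u v
  have a_le: "a u v \<le> (s u)\<^sup>2" for u v
    unfolding a_def s_def out_degree_def out_arcs_def by (auto intro!: card_mono)
  have a_sym: "a u v = a v u" for u v unfolding a_def sym[of u v] ..
  have a_nonneg: "0 \<le> a u v" for u v by (simp add: a_def)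
  \<comment> \<open>At an isolated vertex \<open>s\<close> is 0 and division by it yields 0. No arc
    meets such a vertex, so the identities that cancel \<open>s\<close> hold there too.\<close>
  have a_zero: "a u v = 0" if "s u = 0 \<or> s v = 0" for u v
    using that a_le[of u v] a_le[of v u] a_nonneg[of u v] a_sym[of u v] by auto
  define X where "X = adjacency_matrix \<Gamma>"
  define Y where "Y = inv_sqrt_degree_matrix \<Gamma>"
  have X: "X \<in> carrier_mat n n" and X_index: "\<And>i j. i < n \<Longrightarrow> j < n \<Longrightarrow> X $$ (i, j) = a (vs ! i) (vs ! j)"
    by (simp_all add: X_def adjacency_matrix_def Let_def n_def vs_def a_def)
  have Y: "Y \<in> carrier_mat n n"
    and Y_index: "\<And>i j. i < n \<Longrightarrow> j < n \<Longrightarrow> Y $$ (i, j) = (if i = j then 1 / s (vs ! i) else 0)"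
    by (simp_all add: Y_def inv_sqrt_degree_matrix_def Let_def n_def vs_def s_def)
  have lap: "laplacian \<Gamma> = 1\<^sub>m n - Y * X * Y"
    by (simp add: laplacian_def X_def Y_def n_def vs_def)
  have L: "laplacian \<Gamma> \<in> carrier_mat n n" unfolding lap using X Y by (intro minus_carrier_mat mult_carrier_mat)
  have L_index: "laplacian \<Gamma> $$ (i, j) = Lp (vs ! i) (vs ! j)" if ij: "i < n" "j < n" for i j
  proof -
    have YX: "(Y * X) $$ (i, k) = a (vs ! i) (vs ! k) / s (vs ! i)" if "k < n" for k
    proof -
      have "(Y * X) $$ (i, k) = (\<Sum>l<n. Y $$ (i, l) * X $$ (l, k))"
        using X Y ij that by (simp add: scalar_prod_def atLeast0LessThan)
      also have "\<dots> = (\<Sum>l<n. if l = i then a (vs ! i) (vs ! k) / s (vs ! i) else 0)"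
        by (intro sum.cong) (auto simp: X_index Y_index ij that)
      finally show ?thesis using ij by simp
    qed
    obtain Z where Z: "Z = Y * X" "Z \<in> carrier_mat n n" using X Y by auto
    have "(Z * Y) $$ (i, j) = (\<Sum>k<n. Z $$ (i, k) * Y $$ (k, j))"
      using Z(2) Y ij by (simp add: scalar_prod_def atLeast0LessThan)
    also have "\<dots> = (\<Sum>k<n. if k = j then a (vs ! i) (vs ! j) / (s (vs ! i) * s (vs ! j)) else 0)"
      by (intro sum.cong) (auto simp: Z(1) YX Y_index ij)
    finally have "(Z * Y) $$ (i, j) = a (vs ! i) (vs ! j) / (s (vs ! i) * s (vs ! j))"
      using ij by simp
    moreover have "vs ! i = vs ! j \<longleftrightarrow> i = j"
      using ij vs(1) by (simp add: n_def nth_eq_iff_index_eq)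
    ultimately show ?thesis
      using ij Y Z(2) by (simp add: lap Lp_def flip: Z(1))
  qed
  have L_sym: "(laplacian \<Gamma>)\<^sup>T = laplacian \<Gamma>"
  proof (rule eq_matI)
    fix i j assume "i < dim_row (laplacian \<Gamma>)" "j < dim_col (laplacian \<Gamma>)"
    then have "i < n" "j < n" using L by auto
    then show "(laplacian \<Gamma>)\<^sup>T $$ (i, j) = laplacian \<Gamma> $$ (i, j)"
      using L a_sym[of "vs ! i" "vs ! j"] by (simp add: L_index Lp_def mult.commute)
  qed (use L in auto)
  have row: "(\<Sum>v\<in>verts \<Gamma>. a u v) = (s u)\<^sup>2" if "u \<in> verts \<Gamma>" for u
  proof -
    have "(\<Sum>v\<in>verts \<Gamma>. a u v) = (\<Sum>v\<in>verts \<Gamma>. \<Sum>e\<in>{e \<in> {e \<in> arcs \<Gamma>. tail \<Gamma> e = u}. head \<Gamma> e = v}. 1)"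
      by (intro sum.cong HOL.refl) (auto simp: a_def intro!: arg_cong[of _ _ card])
    also have "\<dots> = (\<Sum>e\<in>{e \<in> arcs \<Gamma>. tail \<Gamma> e = u}. 1)"
      by (intro sum.group) auto
    finally show ?thesis by (simp add: s_def out_degree_def out_arcs_def)
  qed
  \<comment> \<open>The adjacency row of a vertex sums to its degree, so the two parts of the
    Laplacian cancel on \<open>s\<close>.\<close>
  have ker: "(\<Sum>j<n. laplacian \<Gamma> $$ (i, j) * s (vs ! j)) = 0" if i: "i < n" for i
  proof -
    let ?u = "vs ! i"
    have u: "?u \<in> verts \<Gamma>" using i vs(2) nth_mem[of i vs] by (simp add: n_def)
    have "(\<Sum>j<n. laplacian \<Gamma> $$ (i, j) * s (vs ! j)) = (\<Sum>j<n. Lp ?u (vs ! j) * s (vs ! j))"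
      using i by (intro sum.cong HOL.refl) (simp add: L_index)
    also have "\<dots> = (\<Sum>v\<in>verts \<Gamma>. Lp ?u v * s v)"
      by (rule sum.reindex_bij_betw[OF bij])
    also have "\<dots> = (\<Sum>v\<in>verts \<Gamma>. (if v = ?u then s v else 0) - a ?u v / s ?u)"
      by (intro sum.cong HOL.refl) (use a_zero in \<open>force simp: Lp_def field_simps\<close>)
    also have "\<dots> = s ?u - (\<Sum>v\<in>verts \<Gamma>. a ?u v) / s ?u"
      using u by (simp add: sum_subtractf sum_divide_distrib)
    also have "\<dots> = 0" by (simp add: row[OF u] power2_eq_square)
    finally show ?thesis .
  qed
  define N where "N = (\<Sum>i<n. (s (vs ! i))\<^sup>2)"
  have N: "N = real (card (arcs \<Gamma>))"
  proof -
    have "N = (\<Sum>v\<in>verts \<Gamma>. (s v)\<^sup>2)" unfolding N_def by (rule sum.reindex_bij_betw[OF bij])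
    also have "\<dots> = (\<Sum>e\<in>arcs \<Gamma>. 1)" using sum_arcs_by_tail[of "\<lambda>_. 1"] by (simp add: s_def)
    finally show ?thesis by simp
  qed
  have N_pos: "0 < N" using ne by (simp add: N card_gt_0_iff)
  define F where "F i = s (vs ! i) *\<^sub>R f (vs ! i)" for i
  have sq: "s v * s v = real (out_degree \<Gamma> v)" for v by (simp add: s_def)
  have form: "(\<Sum>i<n. \<Sum>j<n. laplacian \<Gamma> $$ (i, j) * rinner (F i) (F j)) =
      (\<Sum>e\<in>arcs \<Gamma>. (norm (f (tail \<Gamma> e) - f (head \<Gamma> e)))\<^sup>2) / 2"
  proof -
    have "(\<Sum>i<n. \<Sum>j<n. laplacian \<Gamma> $$ (i, j) * rinner (F i) (F j)) =
        (\<Sum>i<n. \<Sum>j<n. Lp (vs ! i) (vs ! j) * (s (vs ! i) * (s (vs ! j) * rinner (f (vs ! i)) (f (vs ! j)))))"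
      by (intro sum.cong HOL.refl) (simp add: L_index F_def rinner.scaleR_left rinner.scaleR_right)
    also have "\<dots> = (\<Sum>i<n. \<Sum>v\<in>verts \<Gamma>. Lp (vs ! i) v * (s (vs ! i) * (s v * rinner (f (vs ! i)) (f v))))"
      by (intro sum.cong HOL.refl sum.reindex_bij_betw[OF bij])
    also have "\<dots> = (\<Sum>u\<in>verts \<Gamma>. \<Sum>v\<in>verts \<Gamma>. Lp u v * (s u * (s v * rinner (f u) (f v))))"
      by (rule sum.reindex_bij_betw[OF bij])
    also have "\<dots> = (\<Sum>u\<in>verts \<Gamma>. \<Sum>v\<in>verts \<Gamma>.
        (if v = u then real (out_degree \<Gamma> u) * (norm (f u))\<^sup>2 else 0) - a u v * rinner (f u) (f v))"
    proof (intro sum.cong HOL.refl)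
      fix u v
      show "Lp u v * (s u * (s v * rinner (f u) (f v))) =
          (if v = u then real (out_degree \<Gamma> u) * (norm (f u))\<^sup>2 else 0) - a u v * rinner (f u) (f v)"
      proof (cases "s u = 0 \<or> s v = 0")
        case True
        then show ?thesis using a_zero[OF True] sq[of u] by auto
      next
        case False
        then show ?thesis
          using sq[of u] by (auto simp: Lp_def field_simps rinner_self)
      qed
    qed
    also have "\<dots> = (\<Sum>u\<in>verts \<Gamma>. real (out_degree \<Gamma> u) * (norm (f u))\<^sup>2) -
        (\<Sum>e\<in>arcs \<Gamma>. rinner (f (tail \<Gamma> e)) (f (head \<Gamma> e)))"
      using sum_arcs_by_ends[of "\<lambda>u v. rinner (f u) (f v)"] by (simp add: sum_subtractf a_def)
    also have "(\<Sum>u\<in>verts \<Gamma>. real (out_degree \<Gamma> u) * (norm (f u))\<^sup>2) =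
        (\<Sum>e\<in>arcs \<Gamma>. (norm (f (tail \<Gamma> e)))\<^sup>2)"
      by (rule sum_arcs_by_tail)
    finally have 1: "(\<Sum>i<n. \<Sum>j<n. laplacian \<Gamma> $$ (i, j) * rinner (F i) (F j)) =
        (\<Sum>e\<in>arcs \<Gamma>. (norm (f (tail \<Gamma> e)))\<^sup>2) - (\<Sum>e\<in>arcs \<Gamma>. rinner (f (tail \<Gamma> e)) (f (head \<Gamma> e)))" .
    \<comment> \<open>By symmetry of the graph the sums over heads and over tails agree, which
      completes the square and produces the factor 1/2.\<close>
    have "(\<Sum>e\<in>arcs \<Gamma>. (norm (f (head \<Gamma> e)))\<^sup>2) = (\<Sum>u\<in>verts \<Gamma>. \<Sum>v\<in>verts \<Gamma>. a u v * (norm (f v))\<^sup>2)"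
      using sum_arcs_by_ends[of "\<lambda>u v. (norm (f v))\<^sup>2"] by (simp add: a_def)
    also have "\<dots> = (\<Sum>v\<in>verts \<Gamma>. \<Sum>u\<in>verts \<Gamma>. a v u * (norm (f v))\<^sup>2)"
      by (subst sum.swap) (simp only: a_sym)
    also have "\<dots> = (\<Sum>e\<in>arcs \<Gamma>. (norm (f (tail \<Gamma> e)))\<^sup>2)"
      using sum_arcs_by_ends[of "\<lambda>u v. (norm (f u))\<^sup>2"] by (simp add: a_def)
    finally show ?thesis unfolding 1 norm_diff_rinner
      by (simp add: sum.distrib sum_subtractf flip: sum_distrib_left)
  qed
  have "(\<Sum>i<n. (norm (F i))\<^sup>2) = (\<Sum>v\<in>verts \<Gamma>. real (out_degree \<Gamma> v) * (norm (f v))\<^sup>2)"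
    using sum.reindex_bij_betw[OF bij, of "\<lambda>v. real (out_degree \<Gamma> v) * (norm (f v))\<^sup>2"]
    by (simp add: F_def power_mult_distrib s_def)
  moreover have "(\<Sum>i<n. s (vs ! i) *\<^sub>R F i) = (\<Sum>v\<in>verts \<Gamma>. real (out_degree \<Gamma> v) *\<^sub>R f v)"
    using sum.reindex_bij_betw[OF bij, of "\<lambda>v. real (out_degree \<Gamma> v) *\<^sub>R f v"]
    by (simp add: F_def sq)
  ultimately show ?thesis
    using symmetric_form_ge_second_eigenvalue[OF L L_sym lambda1_def pos ker N_def N_pos, of F]
    by (simp add: form N)
qed

section \<open>Vectors invariant under a finite set of unitaries\<close>

instance complex_hilbert \<subseteq> banach ..

text \<open>In spectral terms, \<open>upper\<close> places the spectrum of \<open>\<Delta>\<close>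
  in [0,2] and \<open>gap\<close> leaves it empty strictly between 0 and \<open>\<kappa>\<close>.
  Iterating \<open>g\<close> replaces the spectral projection to the kernel: the energy
  \<open>e\<close> decays geometrically and bounds the squared increments.\<close>

lemma nearby_kernel_vector:
  fixes \<Delta> :: "'h::complex_hilbert \<Rightarrow> 'h"
  assumes lin: "linear \<Delta>" and sym: "\<And>x y. rinner (\<Delta> x) y = rinner x (\<Delta> y)"
    and upper: "\<And>x. (norm (\<Delta> x))\<^sup>2 \<le> 2 * rinner (\<Delta> x) x"
    and gap: "\<And>x. \<kappa> * rinner (\<Delta> x) x \<le> (norm (\<Delta> x))\<^sup>2" and \<kappa>: "0 < \<kappa>"
  shows "\<exists>C\<ge>0. \<forall>u. \<exists>v. \<Delta> v = 0 \<and> norm (v - u) \<le> C * sqrt (rinner (\<Delta> u) u)"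
proof -
  interpret \<Delta>: linear \<Delta> by fact
  \<comment> \<open>The minimum with 1 keeps \<open>q\<close> at least 1/2, also for large
    \<open>\<kappa>\<close>.\<close>
  define q where "q = 1 - min \<kappa> 1 / 2"
  have q: "0 < q" "q < 1" using \<kappa> by (auto simp: q_def min_def)
  define e where "e x = rinner (\<Delta> x) x" for x
  have e_nonneg: "0 \<le> e x" for x
    using upper[of x] zero_le_power2[of "norm (\<Delta> x)"] unfolding e_def by linarith
  have bound: "norm (\<Delta> x) \<le> 2 * norm x" for x
  proof -
    have "norm (\<Delta> x) * norm (\<Delta> x) \<le> norm (\<Delta> x) * (2 * norm x)"
      using upper[of x] rinner_le_norm[of "\<Delta> x" x] by (simp add: power2_eq_square)
    then show ?thesis by (cases "norm (\<Delta> x) = 0") (auto dest: mult_left_le_imp_le)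
  qed
  have blin: "bounded_linear \<Delta>"
    using bound by (intro bounded_linear_intro[of _ 2]) (auto simp: \<Delta>.add \<Delta>.scale mult.commute)
  define g where "g x = x - (1 / 2) *\<^sub>R \<Delta> x" for x
  \<comment> \<open>Expanding gives \<open>e x - (norm (\<Delta> x))\<^sup>2\<close> plus a quarter
    of \<open>rinner (\<Delta> (\<Delta> x)) (\<Delta> x)\<close>; the bound 2 on the operator norm
    leaves a loss of half of \<open>(norm (\<Delta> x))\<^sup>2\<close>, to which \<open>gap\<close>
    applies.\<close>
  have step: "e (g x) \<le> q * e x" for x
  proof -
    have "e (g x) = e x - (norm (\<Delta> x))\<^sup>2 + rinner (\<Delta> (\<Delta> x)) (\<Delta> x) / 4"
      unfolding e_def g_def
      by (simp add: \<Delta>.diff \<Delta>.scale rinner.diff_left rinner.diff_right rinner.scaleR_left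
          rinner.scaleR_right sym[of "\<Delta> x" x] rinner_self field_simps)
    also have "rinner (\<Delta> (\<Delta> x)) (\<Delta> x) \<le> norm (\<Delta> (\<Delta> x)) * norm (\<Delta> x)" by (rule rinner_le_norm)
    also have "\<dots> \<le> 2 * norm (\<Delta> x) * norm (\<Delta> x)" by (intro mult_right_mono bound) simp
    finally have "e (g x) \<le> e x - (norm (\<Delta> x))\<^sup>2 / 2" by (simp add: power2_eq_square)
    moreover have "min \<kappa> 1 * e x \<le> \<kappa> * e x" using e_nonneg by (intro mult_right_mono) auto
    ultimately show ?thesis using gap[of x] by (simp add: q_def e_def algebra_simps)
  qed
  \<comment> \<open>The sum of the geometric series with ratio \<open>sqrt q\<close>, which bounds
    the total length of the increments.\<close>
  define C where "C = 1 / (1 - sqrt q)"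
  have sq: "0 < sqrt q" "sqrt q < 1" using q by auto
  have C: "0 \<le> C" using sq by (simp add: C_def)
  have "\<exists>v. \<Delta> v = 0 \<and> norm (v - u) \<le> C * sqrt (e u)" for u
  proof -
    define x where "x n = (g ^^ n) u" for n
    have x_Suc: "x (Suc n) = g (x n)" for n by (simp add: x_def)
    have decay: "e (x n) \<le> q ^ n * e u" for n
    proof (induction n)
      case (Suc n)
      have "e (x (Suc n)) \<le> q * e (x n)" unfolding x_Suc by (rule step)
      also have "\<dots> \<le> q * (q ^ n * e u)" using Suc q by (intro mult_left_mono) auto
      finally show ?case by (simp add: mult.assoc)
    qed (simp add: x_def)
    have incr: "norm (x (Suc n) - x n) \<le> sqrt (e u) * sqrt q ^ n" for n
    proof -
      have "norm (x (Suc n) - x n) = norm (\<Delta> (x n)) / 2" by (simp add: x_Suc g_def)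
      moreover have "(norm (\<Delta> (x n)) / 2)\<^sup>2 \<le> e (x n)"
        using upper[of "x n"] e_nonneg[of "x n"] by (simp add: power_divide e_def)
      ultimately have "(norm (x (Suc n) - x n))\<^sup>2 \<le> q ^ n * e u" using decay[of n] by (metis order_trans)
      then have "norm (x (Suc n) - x n) \<le> sqrt (q ^ n * e u)" by (rule real_le_rsqrt)
      then show ?thesis by (simp add: real_sqrt_mult real_sqrt_power mult.commute)
    qed
    have geo: "(\<lambda>n. sqrt (e u) * sqrt q ^ n) sums (sqrt (e u) * (1 / (1 - sqrt q)))"
      using sq by (intro sums_mult geometric_sums) auto
    have summ: "summable (\<lambda>n. norm (x (Suc n) - x n))"
      using incr by (intro summable_comparison_test'[OF sums_summable[OF geo], of 0]) auto
    then have summ': "summable (\<lambda>n. x (Suc n) - x n)" by (rule summable_norm_cancel)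
    define w where "w = (\<Sum>n. x (Suc n) - x n)"
    have tel: "(\<Sum>k<n. x (Suc k) - x k) = x n - u" for n
      using sum_lessThan_telescope[of x n] by (simp add: x_def)
    have "(\<lambda>n. x n - u) \<longlonglongrightarrow> w"
      using summable_LIMSEQ[OF summ'] unfolding tel w_def .
    from tendsto_add[OF this tendsto_const[of u]] have lim: "x \<longlonglongrightarrow> w + u" by simp
    \<comment> \<open>The increments are \<open>\<Delta> (x n)\<close> times -1/2, so
      \<open>\<Delta> (x n)\<close> tends to 0, and by continuity the limit lies in the
      kernel.\<close>
    have "(\<lambda>n. x (Suc n) - x n) \<longlonglongrightarrow> 0" by (rule summable_LIMSEQ_zero[OF summ'])
    from tendsto_scaleR[OF tendsto_const[of "-2"] this] have "(\<lambda>n. \<Delta> (x n)) \<longlonglongrightarrow> 0"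
      by (simp add: x_Suc g_def)
    moreover have "(\<lambda>n. \<Delta> (x n)) \<longlonglongrightarrow> \<Delta> (w + u)"
      by (rule bounded_linear.tendsto[OF blin lim])
    ultimately have "\<Delta> (w + u) = 0" by (metis LIMSEQ_unique)
    moreover have "norm w \<le> C * sqrt (e u)"
    proof -
      have "norm w \<le> (\<Sum>n. norm (x (Suc n) - x n))" unfolding w_def by (rule summable_norm[OF summ])
      also have "\<dots> \<le> sqrt (e u) * (1 / (1 - sqrt q))"
        using suminf_le[OF incr summ sums_summable[OF geo]] sums_unique[OF geo] by simp
      finally show ?thesis by (simp add: C_def)
    qed
    ultimately show ?thesis by (intro exI[of _ "w + u"]) simp
  qed
  then show ?thesis using C unfolding e_def by blast
qed

text \<open>Cauchy-Schwarz for the weights \<open>w\<close>. It serves both the upper bound on the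
  Laplacian, with \<open>a = w\<close> and \<open>c = 1\<close>, and the error due to asymmetric
  weights, with \<open>c = \<epsilon> / 2\<close>.\<close>

lemma norm_weighted_sum_le:
  fixes b :: "'g \<Rightarrow> 'h::real_normed_vector"
  assumes w: "\<And>g. g \<in> K \<Longrightarrow> 0 \<le> w g" and a: "\<And>g. g \<in> K \<Longrightarrow> \<bar>a g\<bar> \<le> c * w g" and c: "0 \<le> c"
  shows "(norm (\<Sum>g\<in>K. a g *\<^sub>R b g))\<^sup>2 \<le> c\<^sup>2 * (sum w K * (\<Sum>g\<in>K. w g * (norm (b g))\<^sup>2))"
proof -
  have "norm (\<Sum>g\<in>K. a g *\<^sub>R b g) \<le> (\<Sum>g\<in>K. norm (a g *\<^sub>R b g))" by (rule norm_sum)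
  also have "\<dots> \<le> (\<Sum>g\<in>K. c * w g * norm (b g))"
    by (intro sum_mono) (auto intro!: mult_right_mono a)
  also have "\<dots> = c * (\<Sum>g\<in>K. sqrt (w g) * (sqrt (w g) * norm (b g)))"
    unfolding sum_distrib_left by (intro sum.cong HOL.refl) (use w in \<open>simp add: mult.assoc[symmetric]\<close>)
  finally have "(norm (\<Sum>g\<in>K. a g *\<^sub>R b g))\<^sup>2 \<le>
      (c * (\<Sum>g\<in>K. sqrt (w g) * (sqrt (w g) * norm (b g))))\<^sup>2"
    by (intro power_mono) auto
  also have "\<dots> = c\<^sup>2 * (\<Sum>g\<in>K. sqrt (w g) * (sqrt (w g) * norm (b g)))\<^sup>2"
    by (simp add: power_mult_distrib)
  also have "\<dots> \<le> c\<^sup>2 * ((\<Sum>g\<in>K. (sqrt (w g))\<^sup>2) * (\<Sum>g\<in>K. (sqrt (w g) * norm (b g))\<^sup>2))"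
    by (intro mult_left_mono Cauchy_Schwarz_ineq_sum) auto
  also have "(\<Sum>g\<in>K. (sqrt (w g))\<^sup>2) = sum w K" using w by (intro sum.cong) auto
  also have "(\<Sum>g\<in>K. (sqrt (w g) * norm (b g))\<^sup>2) = (\<Sum>g\<in>K. w g * (norm (b g))\<^sup>2)"
    using w by (intro sum.cong) (auto simp: power_mult_distrib)
  finally show ?thesis .
qed

text \<open>The Poincare bound concerns the mean with weights \<open>d\<close>, whereas
  self-adjointness of the Laplacian requires weights symmetric under \<open>\<iota>\<close>. The
  proof compares the two at the cost of \<open>\<epsilon> / 2\<close> and obtains the gap that
  yields nearby kernel vectors.\<close>

lemma nearby_invariant_vector:
  fixes U :: "'g \<Rightarrow> 'h::complex_hilbert \<Rightarrow> 'h" and d :: "'g \<Rightarrow> real"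
  assumes K: "finite K" "\<And>g. g \<in> K \<Longrightarrow> \<iota> g \<in> K" "\<And>g. g \<in> K \<Longrightarrow> \<iota> (\<iota> g) = g"
    and lin: "\<And>g. g \<in> K \<Longrightarrow> linear (U g)" and norm: "\<And>g x. g \<in> K \<Longrightarrow> norm (U g x) = norm x"
    and adj: "\<And>g x y. g \<in> K \<Longrightarrow> rinner (U g x) y = rinner x (U (\<iota> g) y)"
    and d: "\<And>g. g \<in> K \<Longrightarrow> 0 \<le> d g" "0 < sum d K"
    and almost_sym: "\<And>g. g \<in> K \<Longrightarrow> d g \<le> (1 + \<epsilon>) * d (\<iota> g)" and \<epsilon>: "0 < \<epsilon>"
    and \<mu>: "0 < \<mu>" "\<theta> / \<mu> < 1 - \<epsilon>\<^sup>2"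
    and E: "\<And>u. E u = (\<Sum>g\<in>K. d g * (norm (U g u - u))\<^sup>2)"
    and poincare: "\<And>u. \<mu> * (E u - (norm (\<Sum>g\<in>K. d g *\<^sub>R (U g u - u)))\<^sup>2 / sum d K) \<le> \<theta> * E u"
  shows "\<exists>C\<ge>0. \<forall>u. \<exists>v. (\<forall>g\<in>K. 0 < d g \<longrightarrow> U g v = v) \<and> norm (v - u) \<le> C * sqrt (E u)"
proof -
  define N where "N = sum d K"
  have N: "0 < N" using d(2) by (simp add: N_def)
  define w where "w g = (d g + d (\<iota> g)) / 2" for g
  have flip: "(\<Sum>g\<in>K. h (\<iota> g)) = (\<Sum>g\<in>K. h g)" for h :: "'g \<Rightarrow> real"
    by (rule sum.reindex_bij_witness[of _ \<iota> \<iota>]) (auto simp: K)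
  have w: "0 \<le> w g" if "g \<in> K" for g using d(1) K(2) that by (simp add: w_def)
  have w_flip: "w (\<iota> g) = w g" if "g \<in> K" for g using K(3) that by (simp add: w_def)
  have sum_w: "sum w K = N"
    using flip[of d] by (simp add: w_def N_def sum.distrib flip: sum_divide_distrib)
  \<comment> \<open>Symmetrising the weights does not change sums of functions invariant under
    \<open>\<iota>\<close>; in particular the energy \<open>E\<close> may be computed with either
    weight.\<close>
  have avg: "(\<Sum>g\<in>K. w g * h g) = (\<Sum>g\<in>K. d g * h g)"
    if "\<And>g. g \<in> K \<Longrightarrow> h (\<iota> g) = h g" for h :: "'g \<Rightarrow> real"
  proof -
    have "(\<Sum>g\<in>K. d (\<iota> g) * h g) = (\<Sum>g\<in>K. d (\<iota> g) * h (\<iota> g))"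
      using that by (intro sum.cong) auto
    also have "\<dots> = (\<Sum>g\<in>K. d g * h g)" by (rule flip[of "\<lambda>g. d g * h g"])
    finally show ?thesis
      by (simp add: w_def add_divide_distrib distrib_right sum.distrib flip: sum_divide_distrib)
  qed
  have sq: "(norm (U g u - u))\<^sup>2 = 2 * rinner (u - U g u) u" if "g \<in> K" for g u
    by (simp add: norm_diff_rinner norm[OF that] rinner.diff_left rinner_self)
  have sq_flip: "(norm (U (\<iota> g) u - u))\<^sup>2 = (norm (U g u - u))\<^sup>2" if "g \<in> K" for g u
    unfolding sq[OF that] sq[OF K(2)[OF that]]
    using adj[OF that, of u u] rinner_commute[of u "U (\<iota> g) u"] by (simp add: rinner.diff_left)
  have E_w: "E u = (\<Sum>g\<in>K. w g * (norm (U g u - u))\<^sup>2)" for u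
    unfolding E by (rule avg[symmetric]) (rule sq_flip)
  define \<Delta> where "\<Delta> u = (1 / N) *\<^sub>R (\<Sum>g\<in>K. w g *\<^sub>R (u - U g u))" for u
  have \<Delta>_lin: "linear \<Delta>"
  proof (rule linearI)
    fix x y :: 'h and r :: real
    have "(\<Sum>g\<in>K. w g *\<^sub>R (x + y - U g (x + y))) =
        (\<Sum>g\<in>K. w g *\<^sub>R (x - U g x)) + (\<Sum>g\<in>K. w g *\<^sub>R (y - U g y))"
      unfolding sum.distrib[symmetric]
      by (intro sum.cong HOL.refl) (simp add: linear_add[OF lin] algebra_simps)
    then show "\<Delta> (x + y) = \<Delta> x + \<Delta> y" by (simp add: \<Delta>_def scaleR_add_right)
    have "(\<Sum>g\<in>K. w g *\<^sub>R (r *\<^sub>R x - U g (r *\<^sub>R x))) = r *\<^sub>R (\<Sum>g\<in>K. w g *\<^sub>R (x - U g x))"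
      unfolding scaleR_sum_right
      by (intro sum.cong HOL.refl) (simp add: linear_scale[OF lin] algebra_simps)
    then show "\<Delta> (r *\<^sub>R x) = r *\<^sub>R \<Delta> x" by (simp add: \<Delta>_def mult.commute)
  qed
  have \<Delta>_sym: "rinner (\<Delta> x) y = rinner x (\<Delta> y)" for x y
  proof -
    have "(\<Sum>g\<in>K. w g * rinner (U g x) y) = (\<Sum>g\<in>K. w (\<iota> g) * rinner x (U (\<iota> g) y))"
      by (intro sum.cong HOL.refl) (simp add: adj w_flip)
    also have "\<dots> = (\<Sum>g\<in>K. w g * rinner x (U g y))" by (rule flip[of "\<lambda>g. w g * rinner x (U g y)"])
    finally show ?thesis
      by (simp add: \<Delta>_def rinner.scaleR_left rinner.scaleR_right rinner.sum_left rinner.sum_right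
          rinner.diff_left rinner.diff_right right_diff_distrib sum_subtractf)
  qed
  have \<Delta>_E: "2 * N * rinner (\<Delta> u) u = E u" for u
  proof -
    have "E u = (\<Sum>g\<in>K. 2 * (w g * rinner (u - U g u) u))"
      unfolding E_w by (intro sum.cong HOL.refl) (simp add: sq)
    then show ?thesis
      using N by (simp add: \<Delta>_def rinner.scaleR_left rinner.sum_left sum_distrib_left mult.assoc)
  qed
  have E_nonneg: "0 \<le> E u" for u unfolding E using d(1) by (intro sum_nonneg) auto
  have \<Delta>_upper: "(norm (\<Delta> u))\<^sup>2 \<le> 2 * rinner (\<Delta> u) u" for u
  proof -
    have "(norm (\<Sum>g\<in>K. w g *\<^sub>R (u - U g u)))\<^sup>2 \<le> 1\<^sup>2 * (sum w K * (\<Sum>g\<in>K. w g * (norm (u - U g u))\<^sup>2))"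
      using w by (intro norm_weighted_sum_le) auto
    also have "\<dots> = N * E u" by (simp add: sum_w E_w norm_minus_commute)
    finally have "(N * norm (\<Delta> u))\<^sup>2 \<le> N * E u"
      using N by (simp add: \<Delta>_def)
    then have "N * (norm (\<Delta> u))\<^sup>2 \<le> E u"
      using N by (simp add: power2_eq_square algebra_simps)
    then have "N * (norm (\<Delta> u))\<^sup>2 \<le> N * (2 * rinner (\<Delta> u) u)" unfolding \<Delta>_E[symmetric] by simp
    then show ?thesis using N by simp
  qed
  \<comment> \<open>The Poincare bound gives \<open>\<rho> * N * E u\<close> as a lower bound for
    the squared norm of the weighted sum \<open>?B\<close> below.\<close>
  define \<rho> where "\<rho> = 1 - \<theta> / \<mu>"
  have \<rho>: "\<epsilon>\<^sup>2 < \<rho>" using \<mu>(2) by (simp add: \<rho>_def)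
  \<comment> \<open>What remains of \<open>sqrt \<rho>\<close> after the asymmetry error; since
    \<open>sqrt \<rho> > \<epsilon>\<close>, it even exceeds \<open>\<epsilon> / 2\<close>.\<close>
  define c where "c = sqrt \<rho> - \<epsilon> / 2"
  have c: "0 < c" using \<rho> \<epsilon> real_less_rsqrt[of \<epsilon> \<rho>] by (simp add: c_def)
  have \<Delta>_gap: "2 * c\<^sup>2 * rinner (\<Delta> u) u \<le> (norm (\<Delta> u))\<^sup>2" for u
  proof -
    let ?B = "\<Sum>g\<in>K. d g *\<^sub>R (U g u - u)" and ?Q = "\<Sum>g\<in>K. (d g - w g) *\<^sub>R (U g u - u)"
    have B: "?B = ?Q - N *\<^sub>R \<Delta> u"
      using N by (simp add: \<Delta>_def algebra_simps sum.distrib sum_subtractf)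
    \<comment> \<open>The difference is half of \<open>d g - d (\<iota> g)\<close>. The hypothesis
      at \<open>g\<close> bounds it when \<open>d g\<close> is the larger value, the hypothesis at
      \<open>\<iota> g\<close> when it is the smaller one.\<close>
    have "\<bar>d g - w g\<bar> \<le> \<epsilon> / 2 * d g" if g: "g \<in> K" for g
    proof -
      have "d g \<le> d (\<iota> g) + \<epsilon> * d (\<iota> g)" "d (\<iota> g) \<le> d g + \<epsilon> * d g"
        using almost_sym[OF g] almost_sym[OF K(2)[OF g]] K(3)[OF g] by (auto simp: algebra_simps)
      moreover have "\<epsilon> * d (\<iota> g) \<le> \<epsilon> * d g" if "d (\<iota> g) \<le> d g"
        using \<epsilon> that by (intro mult_left_mono) auto
      moreover have "0 \<le> \<epsilon> * d g" using \<epsilon> d(1) g by simp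
      ultimately show ?thesis by (cases "d (\<iota> g) \<le> d g") (auto simp: w_def abs_if field_simps)
    qed
    then have "(norm ?Q)\<^sup>2 \<le> (\<epsilon> / 2)\<^sup>2 * (sum d K * (\<Sum>g\<in>K. d g * (norm (U g u - u))\<^sup>2))"
      using d(1) \<epsilon> by (intro norm_weighted_sum_le) auto
    then have "norm ?Q \<le> sqrt ((\<epsilon> / 2)\<^sup>2 * (N * E u))" unfolding N_def E by (rule real_le_rsqrt)
    also have "\<dots> = \<epsilon> / 2 * sqrt (N * E u)" using \<epsilon> by (simp add: real_sqrt_mult)
    finally have Q: "norm ?Q \<le> \<epsilon> / 2 * sqrt (N * E u)" .
    have "\<mu> * (E u - (norm ?B)\<^sup>2 / N) \<le> \<mu> * (\<theta> / \<mu> * E u)"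
      using poincare[of u] \<mu>(1) by (simp add: N_def)
    then have "E u - (norm ?B)\<^sup>2 / N \<le> \<theta> / \<mu> * E u"
      using \<mu>(1) mult_le_cancel_left_pos by blast
    then have "\<rho> * (N * E u) \<le> (norm ?B)\<^sup>2"
      using N by (simp add: \<rho>_def field_simps)
    then have "sqrt (\<rho> * (N * E u)) \<le> norm ?B" by (rule real_le_lsqrt[OF norm_ge_zero])
    then have "sqrt \<rho> * sqrt (N * E u) \<le> norm ?B" by (simp add: real_sqrt_mult)
    also have "\<dots> \<le> norm ?Q + norm (N *\<^sub>R \<Delta> u)" unfolding B by (rule norm_triangle_ineq4)
    finally have "c * sqrt (N * E u) \<le> N * norm (\<Delta> u)"
      using Q N by (simp add: c_def left_diff_distrib)
    then have "(c * sqrt (N * E u))\<^sup>2 \<le> (N * norm (\<Delta> u))\<^sup>2"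
      using c N E_nonneg[of u] by (intro power_mono) auto
    then have "c\<^sup>2 * (N * E u) \<le> N\<^sup>2 * (norm (\<Delta> u))\<^sup>2"
      using N E_nonneg[of u] by (simp add: power_mult_distrib)
    then have "N\<^sup>2 * (2 * c\<^sup>2 * rinner (\<Delta> u) u) \<le> N\<^sup>2 * (norm (\<Delta> u))\<^sup>2"
      unfolding \<Delta>_E[symmetric] by (simp add: power2_eq_square algebra_simps)
    then show ?thesis using N by simp
  qed
  have "0 < 2 * c\<^sup>2" using c by simp
  from nearby_kernel_vector[OF \<Delta>_lin \<Delta>_sym \<Delta>_upper \<Delta>_gap this] obtain C where
    C: "0 \<le> C" "\<And>u. \<exists>v. \<Delta> v = 0 \<and> norm (v - u) \<le> C * sqrt (rinner (\<Delta> u) u)" by auto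
  show ?thesis
  proof (intro exI[of _ "C / sqrt (2 * N)"] conjI allI)
    show "0 \<le> C / sqrt (2 * N)" using C(1) N by simp
    fix u
    obtain v where v: "\<Delta> v = 0" "norm (v - u) \<le> C * sqrt (rinner (\<Delta> u) u)" using C(2) by blast
    \<comment> \<open>A kernel vector has energy 0, and a sum of non-negative terms vanishes only
      termwise; hence only elements of positive weight are known to fix it.\<close>
    have "E v = 0" using \<Delta>_E[of v] v(1) by (simp add: rinner.zero_left)
    then have "\<forall>g\<in>K. d g * (norm (U g v - v))\<^sup>2 = 0"
      unfolding E using K(1) d(1) by (subst (asm) sum_nonneg_eq_0_iff) auto
    then have "\<forall>g\<in>K. 0 < d g \<longrightarrow> U g v = v" by auto
    moreover have "rinner (\<Delta> u) u = E u / (2 * N)" using \<Delta>_E[of u] N by (simp add: field_simps)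
    ultimately show "\<exists>v. (\<forall>g\<in>K. 0 < d g \<longrightarrow> U g v = v) \<and> norm (v - u) \<le> C / sqrt (2 * N) * sqrt (E u)"
      using v(2) by (intro exI[of _ v]) (auto simp: real_sqrt_divide)
  qed
qed

section \<open>Unitary representations of groups\<close>

lemma unitary_linear: "unitary U \<Longrightarrow> linear U"
  unfolding unitary_def by (intro linearI) (auto simp flip: scaleC_of_real)

lemma unitary_rinner: "unitary U \<Longrightarrow> rinner (U x) (U y) = rinner x y"
  by (simp add: unitary_def rinner_def)

lemma unitary_norm: "unitary U \<Longrightarrow> norm (U x) = norm x"
  using unitary_rinner[of U x x] by (simp add: rinner_self)

lemma unitary_norm_diff: "unitary U \<Longrightarrow> norm (U x - U y) = norm (x - y)"
  using unitary_norm[of U "x - y"] by (simp add: linear_diff[OF unitary_linear])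

locale unitary_representation = group G for G (structure) +
  fixes U :: "'g \<Rightarrow> 'h::complex_hilbert \<Rightarrow> 'h"
  assumes rep: "unitary_rep G U"
begin

lemma unitary: "g \<in> carrier G \<Longrightarrow> unitary (U g)"
  using rep by (simp add: unitary_rep_def)

lemma rep_mult: "g \<in> carrier G \<Longrightarrow> h \<in> carrier G \<Longrightarrow> U (g \<otimes> h) x = U g (U h x)"
  using rep by (simp add: unitary_rep_def)

text \<open>The operator at the unit is idempotent and isometric, hence the identity;
  \<open>unitary_rep\<close> itself demands only multiplicativity.\<close>

lemma rep_one: "U \<one> x = x"
  using unitary_norm_diff[OF unitary, of \<one> "U \<one> x" x] rep_mult[of \<one> \<one> x] by simp

lemma rep_inv: "g \<in> carrier G \<Longrightarrow> U (inv g) (U g x) = x"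
  using rep_mult[of "inv g" g x] by (simp add: rep_one)

lemma adjoint: "g \<in> carrier G \<Longrightarrow> rinner (U g x) y = rinner x (U (inv g) y)"
  using unitary_rinner[OF unitary, of "inv g" "U g x" y] by (simp add: rep_inv)

lemma norm_inv_diff: "g \<in> carrier G \<Longrightarrow> norm (U (inv g) x - x) = norm (U g x - x)"
  using unitary_norm_diff[OF unitary, of "inv g" x "U g x"] by (simp add: rep_inv norm_minus_commute)

lemma subgroup_stabiliser: "subgroup {g \<in> carrier G. U g v = v} G"
proof (rule subgroupI)
  show "{g \<in> carrier G. U g v = v} \<noteq> {}" using rep_one by auto
  show "inv g \<in> {g \<in> carrier G. U g v = v}" if "g \<in> {g \<in> carrier G. U g v = v}" for g
    using that rep_inv[of g v] by simp
qed (auto simp: rep_mult)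

lemma generate_fixes:
  assumes "\<And>k. k \<in> K \<Longrightarrow> k \<in> carrier G \<and> U k v = v" and "h \<in> generate G K"
  shows "U h v = v"
  using generate_subgroup_incl[OF _ subgroup_stabiliser, of K v] assms by blast

text \<open>Displacement is subadditive under products and unchanged by inversion, so
  \<open>c\<close> can be the number of generators in an expression of \<open>g\<close>, uniformly
  in \<open>u\<close>.\<close>

lemma displacement_bound:
  assumes A: "A \<subseteq> carrier G" and g: "g \<in> generate G A"
  shows "\<exists>c\<ge>0. \<forall>u \<eta>. 0 \<le> \<eta> \<longrightarrow> (\<forall>a\<in>A. norm (U a u - u) \<le> \<eta>) \<longrightarrow> norm (U g u - u) \<le> c * \<eta>"
  using g
proof (induction rule: generate.induct)
  case one
  then show ?case by (intro exI[of _ 0]) (simp add: rep_one)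
next
  case (incl h)
  then show ?case by (intro exI[of _ 1]) simp
next
  case (inv h)
  then show ?case using A by (intro exI[of _ 1]) (auto simp: norm_inv_diff)
next
  case (eng g h)
  from eng.IH obtain c d where c: "0 \<le> c" "0 \<le> d"
    "\<And>u \<eta>. 0 \<le> \<eta> \<Longrightarrow> \<forall>a\<in>A. norm (U a u - u) \<le> \<eta> \<Longrightarrow> norm (U g u - u) \<le> c * \<eta>"
    "\<And>u \<eta>. 0 \<le> \<eta> \<Longrightarrow> \<forall>a\<in>A. norm (U a u - u) \<le> \<eta> \<Longrightarrow> norm (U h u - u) \<le> d * \<eta>"
    by blast
  have gh: "g \<in> carrier G" "h \<in> carrier G" using eng.hyps generate_in_carrier[OF A] by auto
  have "norm (U (g \<otimes> h) u - u) \<le> norm (U h u - u) + norm (U g u - u)" for u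
    using norm_triangle_ineq[of "U g (U h u) - U g u" "U g u - u"]
    by (simp add: rep_mult gh unitary_norm_diff[OF unitary])
  then have "norm (U (g \<otimes> h) u - u) \<le> (c + d) * \<eta>"
    if "0 \<le> \<eta>" "\<forall>a\<in>A. norm (U a u - u) \<le> \<eta>" for u \<eta>
    using c(3,4)[OF that] by (fastforce simp: algebra_simps intro: order_trans)
  then show ?case using c(1,2) by (intro exI[of _ "c + d"]) simp
qed

lemma almost_invariant_on_finite:
  assumes A: "finite_generating_set G A" and ai: "almost_invariant_vectors A U"
    and F: "finite F" "F \<subseteq> carrier G" and \<theta>: "0 < \<theta>"
  obtains u where "u \<noteq> 0" "\<And>g. g \<in> F \<Longrightarrow> norm (U g u - u) \<le> \<theta> * norm u"
proof -
  have gen: "A \<subseteq> carrier G" "generate G A = carrier G"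
    using A by (auto simp: finite_generating_set_def)
  have "\<forall>g\<in>F. \<exists>c\<ge>0. \<forall>u \<eta>. 0 \<le> \<eta> \<longrightarrow> (\<forall>a\<in>A. norm (U a u - u) \<le> \<eta>) \<longrightarrow> norm (U g u - u) \<le> c * \<eta>"
    using displacement_bound[OF gen(1)] F(2) gen(2) by blast
  then obtain c where c: "\<And>g. g \<in> F \<Longrightarrow> 0 \<le> c g"
    "\<And>g u \<eta>. g \<in> F \<Longrightarrow> 0 \<le> \<eta> \<Longrightarrow> \<forall>a\<in>A. norm (U a u - u) \<le> \<eta> \<Longrightarrow> norm (U g u - u) \<le> c g * \<eta>"
    by metis
  \<comment> \<open>Adding 1 keeps \<open>C\<close> positive even if all the constants vanish or
    \<open>F\<close> is empty.\<close>
  define C where "C = sum c F + 1"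
  have C: "0 < C" using c(1) by (simp add: C_def sum_nonneg add_nonneg_pos)
  obtain u where u: "u \<noteq> 0" "\<And>a. a \<in> A \<Longrightarrow> norm (U a u - u) < \<theta> / C * norm u"
    using ai \<theta> C unfolding almost_invariant_vectors_def by (meson divide_pos_pos)
  show ?thesis
  proof (rule that[OF u(1)])
    fix g assume g: "g \<in> F"
    have "norm (U g u - u) \<le> c g * (\<theta> / C * norm u)"
      using u(2) \<theta> C by (intro c(2)[OF g]) (auto intro: less_imp_le)
    also have "\<dots> \<le> C * (\<theta> / C * norm u)"
    proof (rule mult_right_mono)
      show "c g \<le> C" using member_le_sum[of g F c] g c(1) F(1) by (simp add: C_def)
    qed (use \<theta> C in auto)
    finally show "norm (U g u - u) \<le> \<theta> * norm u" using C by simp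
  qed
qed

section \<open>From invariance under a finite index subgroup to invariance under the group\<close>

text \<open>Summing the translates of \<open>v\<close> by inverse coset representatives gives an
  invariant vector, non-zero when each translate is closer to \<open>v\<close> than
  \<open>norm v\<close>. The set \<open>F\<close> is fixed before \<open>v\<close>, so that almost
  invariant vectors can be chosen for it.\<close>

lemma finite_index_invariant_vector:
  assumes H: "finite_index G H"
  obtains F where "finite F" "F \<subseteq> carrier G"
    "\<And>v. (\<And>h. h \<in> H \<Longrightarrow> U h v = v) \<Longrightarrow> (\<And>g. g \<in> F \<Longrightarrow> norm (U g v - v) < norm v) \<Longrightarrow>
      has_invariant_vector G U"
proof -
  have sub: "subgroup H G" and fin: "finite (rcosets H)" using H by (auto simp: finite_index_def)
  interpret H: subgroup H G by (rule sub)
  define r where "r c = (SOME g. g \<in> c)" for c :: "'g set"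
  have r_in: "r c \<in> c" if "c \<in> rcosets H" for c
    using H.rcosets_non_empty[OF that] unfolding r_def by (meson ex_in_conv someI_ex)
  have r_car: "r c \<in> carrier G" if "c \<in> rcosets H" for c
    using r_in[OF that] H.rcosets_carrier[OF is_group that] by blast
  have ne: "rcosets H \<noteq> {}" using rcosetsI[OF H.subset one_closed] by auto
  show ?thesis
  proof (rule that)
    show "finite ((\<lambda>c. inv (r c)) ` (rcosets H))" using fin by simp
    show "(\<lambda>c. inv (r c)) ` (rcosets H) \<subseteq> carrier G" using r_car by auto
    fix v
    assume Hv: "\<And>h. h \<in> H \<Longrightarrow> U h v = v"
      and close: "\<And>g. g \<in> (\<lambda>c. inv (r c)) ` (rcosets H) \<Longrightarrow> norm (U g v - v) < norm v"
    define \<phi> where "\<phi> c = U (inv (r c)) v" for c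
    \<comment> \<open>Two representatives of a right coset differ by a left factor from
      \<open>H\<close>, whose inverse acts first on \<open>v\<close> and fixes it.\<close>
    have \<phi>: "\<phi> c = U (inv g) v" if c: "c \<in> rcosets H" and g: "g \<in> c" for c g
    proof -
      obtain a where a: "a \<in> carrier G" "c = H #> a" using c by (auto simp: RCOSETS_def)
      have gc: "g \<in> carrier G" using g H.rcosets_carrier[OF is_group c] by blast
      have "c = H #> r c" using repr_independence[of "r c" H a] r_in[OF c] a sub by simp
      with g obtain h where h: "h \<in> H" "g = h \<otimes> r c" by (auto simp: r_coset_def)
      have "U (inv g) v = U (inv (r c)) (U (inv h) v)"
        using h r_car[OF c] H.mem_carrier by (simp add: inv_mult_group rep_mult)
      then show ?thesis using Hv h by (simp add: \<phi>_def)
    qed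
    define P where "P = (\<Sum>c\<in>rcosets H. \<phi> c)"
    have shift: "c #> a \<in> rcosets H" if "c \<in> rcosets H" "a \<in> carrier G" for c a
      using that H.subset by (auto simp: RCOSETS_def coset_mult_assoc)
    have unshift: "(c #> a) #> inv a = c" if "c \<in> rcosets H" "a \<in> carrier G" for c a
      using that H.rcosets_carrier[OF is_group that(1)] by (simp add: coset_mult_assoc coset_mult_one)
    \<comment> \<open>Right multiplication by the inverse of \<open>a\<close> permutes the right
      cosets, and \<open>U a\<close> permutes the summands accordingly.\<close>
    have "U a P = P" if a: "a \<in> carrier G" for a
    proof -
      have "U a P = (\<Sum>c\<in>rcosets H. U a (\<phi> c))"
        unfolding P_def by (rule linear_sum[OF unitary_linear[OF unitary[OF a]]])
      also have "\<dots> = (\<Sum>c\<in>rcosets H. \<phi> (c #> inv a))"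
      proof (rule sum.cong[OF HOL.refl])
        fix c assume c: "c \<in> rcosets H"
        have "r c \<otimes> inv a \<in> c #> inv a" using r_in[OF c] by (auto simp: r_coset_def)
        then have "\<phi> (c #> inv a) = U (inv (r c \<otimes> inv a)) v"
          using \<phi> shift[OF c] a by simp
        also have "\<dots> = U a (\<phi> c)"
          using a r_car[OF c] by (simp add: inv_mult_group rep_mult \<phi>_def)
        finally show "U a (\<phi> c) = \<phi> (c #> inv a)" by simp
      qed
      also have "\<dots> = P" unfolding P_def
        by (rule sum.reindex_bij_witness[of _ "\<lambda>c. c #> a" "\<lambda>c. c #> inv a"])
          (use a shift unshift[of _ a] unshift[of _ "inv a"] in auto)
      finally show ?thesis .
    qed
    moreover have "P \<noteq> 0"
    proof
      assume "P = 0"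
      have "P - real (card (rcosets H)) *\<^sub>R v = (\<Sum>c\<in>rcosets H. \<phi> c - v)"
        by (simp add: P_def sum_subtractf sum_constant_scaleR)
      then have "real (card (rcosets H)) * norm v = norm (\<Sum>c\<in>rcosets H. \<phi> c - v)"
        using \<open>P = 0\<close> by (metis norm_minus_cancel norm_scaleR abs_of_nat diff_0)
      also have "\<dots> \<le> (\<Sum>c\<in>rcosets H. norm (\<phi> c - v))" by (rule norm_sum)
      also have "\<dots> < (\<Sum>c\<in>rcosets H. norm v)"
        using fin ne close by (intro sum_strict_mono) (auto simp: \<phi>_def)
      finally show False by simp
    qed
    ultimately show "has_invariant_vector G U" unfolding has_invariant_vector_def by blast
  qed
qed

text \<open>Almost invariance is asked for on every finite subset, the form in which it can be
  pulled back from a quotient.\<close>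

lemma has_invariant_vector_if_nearby:
  assumes ai: "\<And>F \<theta>. finite F \<Longrightarrow> F \<subseteq> carrier G \<Longrightarrow> 0 < \<theta> \<Longrightarrow>
      \<exists>u. u \<noteq> 0 \<and> (\<forall>g\<in>F. norm (U g u - u) \<le> \<theta> * norm u)"
    and H: "finite_index G H" and K: "finite K" "K \<subseteq> carrier G" and C: "0 \<le> C"
    and nearby: "\<And>u t. 0 \<le> t \<Longrightarrow> (\<And>g. g \<in> K \<Longrightarrow> norm (U g u - u) \<le> t) \<Longrightarrow>
      \<exists>v. (\<forall>h\<in>H. U h v = v) \<and> norm (v - u) \<le> C * t"
  shows "has_invariant_vector G U"
proof -
  obtain F where F: "finite F" "F \<subseteq> carrier G"
    "\<And>v. (\<And>h. h \<in> H \<Longrightarrow> U h v = v) \<Longrightarrow> (\<And>g. g \<in> F \<Longrightarrow> norm (U g v - v) < norm v) \<Longrightarrow>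
      has_invariant_vector G U"
    using finite_index_invariant_vector[OF H] by blast
  \<comment> \<open>An element of \<open>F\<close> moves \<open>v\<close> by at most
    \<open>(2 * C + 1) * \<theta> * norm u\<close>, while \<open>norm v\<close> is at least
    \<open>(1 - C * \<theta>) * norm u\<close>; thus \<open>(3 * C + 1) * \<theta> < 1\<close>
    suffices.\<close>
  define \<theta> where "\<theta> = 1 / (3 * C + 2)"
  have \<theta>: "0 < \<theta>" "(3 * C + 1) * \<theta> < 1" using C by (auto simp: \<theta>_def)
  obtain u where u: "u \<noteq> 0" "\<And>g. g \<in> F \<union> K \<Longrightarrow> norm (U g u - u) \<le> \<theta> * norm u"
    using ai[of "F \<union> K" \<theta>] F(1,2) K \<theta>(1) by auto
  obtain v where v: "\<And>h. h \<in> H \<Longrightarrow> U h v = v" "norm (v - u) \<le> C * (\<theta> * norm u)"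
    using nearby[of "\<theta> * norm u" u] u(2) \<theta>(1) by auto
  show ?thesis
  proof (rule F(3))
    fix g assume g: "g \<in> F"
    have "norm (U g v - v) \<le> norm (U g v - U g u) + norm (U g u - u) + norm (u - v)"
      using norm_triangle_ineq[of "U g v - U g u" "U g u - v"] norm_triangle_ineq[of "U g u - u" "u - v"]
      by simp
    also have "norm (U g v - U g u) = norm (v - u)"
      using g F(2) by (intro unitary_norm_diff unitary) auto
    also have "norm (v - u) + norm (U g u - u) + norm (u - v) \<le>
        C * (\<theta> * norm u) + \<theta> * norm u + C * (\<theta> * norm u)"
      using v(2) u(2)[of g] g by (intro add_mono) (simp_all add: norm_minus_commute[of u v])
    also have "\<dots> = (3 * C + 1) * \<theta> * norm u - C * (\<theta> * norm u)" by (simp add: algebra_simps)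
    also have "\<dots> < 1 * norm u - C * (\<theta> * norm u)"
      using \<theta>(2) u(1) by (intro diff_strict_right_mono mult_strict_right_mono) auto
    also have "\<dots> \<le> norm v"
      using v(2) norm_triangle_ineq[of v "u - v"] by (simp add: norm_minus_commute)
    finally show "norm (U g v - v) < norm v" .
  qed (rule v(1))
qed

end

section \<open>Passage between a group and its quotient\<close>

lemma (in normal) unitary_rep_pullback:
  assumes "unitary_rep (G Mod H) \<pi>"
  shows "unitary_rep G (\<lambda>g. \<pi> (H #> g))"
  using assms rcosetsI[OF subset] unfolding unitary_rep_def
  by (simp add: FactGroup_def flip: rcos_sum)

lemma (in normal) finite_generating_set_Mod:
  assumes "finite_generating_set G A"
  shows "finite_generating_set (G Mod H) ((\<lambda>g. H #> g) ` A)"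
proof -
  interpret hom: group_hom G "G Mod H" "\<lambda>g. H #> g"
    using r_coset_hom_Mod factorgroup_is_group by (simp add: group_hom_def group_hom_axioms_def is_group)
  have "generate (G Mod H) ((\<lambda>g. H #> g) ` A) = (\<lambda>g. H #> g) ` carrier G"
    using assms hom.generate_img[of A] by (simp add: finite_generating_set_def)
  also have "\<dots> = carrier (G Mod H)" by (auto simp: FactGroup_def RCOSETS_def)
  finally show ?thesis
    using assms rcosetsI[OF subset] by (auto simp: finite_generating_set_def FactGroup_def)
qed

section \<open>The graph of a set of triples\<close>

lemma (in group) normal_closure:
  assumes "K \<subseteq> carrier G"
  shows "normal_closure G K \<lhd> G" "K \<subseteq> normal_closure G K"
proof -
  \<comment> \<open>Guarantees that the intersection is not taken over an empty family.\<close>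
  have "carrier G \<lhd> G" by (simp add: normal_inv_iff subgroup_self)
  then have "{N. N \<lhd> G \<and> K \<subseteq> N} \<noteq> {}" using assms by blast
  then show "normal_closure G K \<lhd> G"
    unfolding normal_closure_def normal_inv_iff by (auto intro!: subgroups_Inter)
  show "K \<subseteq> normal_closure G K" by (auto simp: normal_closure_def)
qed

lemma word_img_in_carrier: "w \<in> lists (letters S) \<Longrightarrow> word_img S T w \<in> carrier (presented_group S T)"
  by (simp add: carrier_presented_group)

lemma word_img_inv_word:
  assumes "T \<subseteq> lists (letters S)" "w \<in> lists (letters S)"
  shows "word_img S T (inv_word w) = inv\<^bsub>presented_group S T\<^esub> word_img S T w"
proof -
  interpret group "presented_group S T" by (rule group_presented_group[OF assms(1)])
  have iw: "inv_word w \<in> lists (letters S)" by (rule inv_word_in[OF assms(2)])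
  have "word_eq S T (inv_word w @ w) []" using word_eq_inv[OF iw, of T] by simp
  then have "word_img S T (inv_word w @ w) = word_img S T []"
    using assms iw by (subst word_img_eq_iff) auto
  then have "word_img S T (inv_word w) \<otimes>\<^bsub>presented_group S T\<^esub> word_img S T w = \<one>\<^bsub>presented_group S T\<^esub>"
    using word_img_mult[OF assms(1) iw assms(2)] by (simp add: presented_group_def)
  from inv_equality[OF this] show ?thesis
    using word_img_in_carrier[OF assms(2)] word_img_in_carrier[OF iw] by simp
qed

lemma finite_generating_set_presented_group:
  assumes "finite_presentation S T"
  shows "finite_generating_set (presented_group S T) ((\<lambda>a. word_img S T [a]) ` letters S)"
proof -
  have S: "finite S" and T: "T \<subseteq> lists (letters S)" using assms by (auto simp: finite_presentation_def)
  let ?G = "presented_group S T" and ?A = "(\<lambda>a. word_img S T [a]) ` letters S"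
  interpret group ?G by (rule group_presented_group[OF T])
  have A: "?A \<subseteq> carrier ?G" by (auto intro!: word_img_in_carrier)
  have "word_img S T w \<in> generate ?G ?A" if "w \<in> lists (letters S)" for w
    using that
  proof (induction w)
    case Nil
    then show ?case using generate.one[of ?G ?A] by (simp add: presented_group_def)
  next
    case (Cons a w)
    have "word_img S T [a] \<otimes>\<^bsub>?G\<^esub> word_img S T w \<in> generate ?G ?A"
      by (rule generate.eng[OF generate.incl]) (use Cons in auto)
    then show ?case using word_img_mult[OF T, of "[a]" w] Cons.hyps by simp
  qed
  then have "generate ?G ?A = carrier ?G"
    using generate_incl[OF A] by (auto simp: carrier_presented_group)
  moreover have "finite ?A" using S by (simp add: letters_def)
  ultimately show ?thesis using A by (simp add: finite_generating_set_def)
qed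

section \<open>Counting arcs, triples and vertices over a group element\<close>

lemma finite_triple_words: "finite R \<Longrightarrow> finite (triple_words R)"
  by (auto simp: triple_words_def)

lemma fin_digraph_Upsilon:
  assumes "finite R"
  shows "fin_digraph (Upsilon R)"
proof
  show "finite (verts (Upsilon R))" using finite_triple_words[OF assms] by (simp add: Upsilon_def)
  show "finite (arcs (Upsilon R))" using assms by (simp add: Upsilon_def)
  fix e assume "e \<in> arcs (Upsilon R)"
  then obtain x y z b where e: "e = ((x, y, z), b)" "(x, y, z) \<in> R" by (cases e) (auto simp: Upsilon_def)
  then have "x \<in> triple_words R" "z \<in> triple_words R" by (force simp: triple_words_def)+
  then show "tail (Upsilon R) e \<in> verts (Upsilon R)" "head (Upsilon R) e \<in> verts (Upsilon R)"
    using e(1) by (auto simp: Upsilon_def)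
qed

text \<open>Negating the Boolean tag of an arc swaps its tail and head.\<close>

lemma Upsilon_symmetric:
  "card {e \<in> arcs (Upsilon R). tail (Upsilon R) e = u \<and> head (Upsilon R) e = v} =
   card {e \<in> arcs (Upsilon R). tail (Upsilon R) e = v \<and> head (Upsilon R) e = u}"
  by (rule bij_betw_same_card, rule bij_betw_byWitness[of _ "\<lambda>(r, b). (r, \<not> b)" "\<lambda>(r, b). (r, \<not> b)"])
    (auto simp: Upsilon_def split: if_splits)

lemma card_arcs_Upsilon: "card (arcs (Upsilon R)) = 2 * card R"
  by (simp add: Upsilon_def card_cartesian_product)

lemma sum_arcs_Upsilon:
  fixes \<phi> :: "'a word \<Rightarrow> 'a word \<Rightarrow> real"
  assumes "\<And>u v. \<phi> u v = \<phi> v u"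
  shows "(\<Sum>e\<in>arcs (Upsilon R). \<phi> (tail (Upsilon R) e) (head (Upsilon R) e)) =
    2 * (\<Sum>(x, y, z)\<in>R. \<phi> x (inv_word z))"
proof -
  have "(\<Sum>e\<in>arcs (Upsilon R). \<phi> (tail (Upsilon R) e) (head (Upsilon R) e)) =
      (\<Sum>r\<in>R. \<Sum>b\<in>UNIV. \<phi> (tail (Upsilon R) (r, b)) (head (Upsilon R) (r, b)))"
    by (simp add: Upsilon_def sum.cartesian_product split_def cong: if_cong)
  also have "\<dots> = (\<Sum>(x, y, z)\<in>R. 2 * \<phi> x (inv_word z))"
    by (intro sum.cong HOL.refl) (auto simp: Upsilon_def UNIV_bool assms[of "inv_word _"])
  finally show ?thesis by (simp add: sum_distrib_left split_def)
qed

text \<open>Double counting: triples are grouped once by their middle word and once by its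
  inverse.\<close>

lemma sum_rep_word:
  fixes \<phi> :: "'a word \<Rightarrow> real"
  assumes "finite R"
  shows "(\<Sum>v\<in>verts (Upsilon R). real (rep_word R v) * \<phi> v) =
    (\<Sum>(x, y, z)\<in>R. \<phi> y + \<phi> (inv_word y))"
proof -
  let ?V = "verts (Upsilon R)"
  let ?m = "\<lambda>r :: 'a triple. fst (snd r)"
  have V: "finite ?V" using finite_triple_words[OF assms] by (simp add: Upsilon_def)
  have m: "?m r \<in> ?V \<and> inv_word (?m r) \<in> ?V" if "r \<in> R" for r
    using that by (cases r) (force simp: Upsilon_def triple_words_def)
  have count: "(\<Sum>v\<in>?V. real (card {r \<in> R. k r = v}) * \<phi> v) = (\<Sum>r\<in>R. \<phi> (k r))"
    if "\<And>r. r \<in> R \<Longrightarrow> k r \<in> ?V" for k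
  proof -
    have "(\<Sum>r\<in>R. \<phi> (k r)) = (\<Sum>v\<in>?V. \<Sum>r\<in>{r \<in> R. k r = v}. \<phi> (k r))"
      using assms V that by (intro sum.group[symmetric]) auto
    then show ?thesis by simp
  qed
  have "rep_word R v = card {r \<in> R. ?m r = v} + card {r \<in> R. inv_word (?m r) = v}" for v
    unfolding rep_word_def
    by (intro arg_cong2[of _ _ _ _ "(+)"] arg_cong[of _ _ card]) auto
  then show ?thesis
    using count[of ?m] count[of "\<lambda>r. inv_word (?m r)"] m
    by (simp add: distrib_right sum.distrib split_def)
qed

text \<open>Different vertices may represent one group element. Summing over fibres passes from
  words to elements, for degrees as well as for \<open>rep_word\<close>.\<close>

lemma sum_vertices_over:
  fixes h :: "'a word set \<Rightarrow> 'b::real_vector" and m :: "'a word \<Rightarrow> nat"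
  assumes "finite R"
  shows "(\<Sum>v\<in>verts (Upsilon R). real (m v) *\<^sub>R h (word_img S T v)) =
    (\<Sum>g\<in>word_img S T ` verts (Upsilon R). real (\<Sum>w\<in>vertices_over S T R g. m w) *\<^sub>R h g)"
proof -
  have V: "finite (verts (Upsilon R))" using finite_triple_words[OF assms] by (simp add: Upsilon_def)
  have "(\<Sum>v\<in>verts (Upsilon R). real (m v) *\<^sub>R h (word_img S T v)) =
    (\<Sum>g\<in>word_img S T ` verts (Upsilon R). \<Sum>w\<in>{w \<in> verts (Upsilon R). word_img S T w = g}.
      real (m w) *\<^sub>R h (word_img S T w))"
    using V by (intro sum.group[symmetric]) auto
  also have "\<dots> = (\<Sum>g\<in>word_img S T ` verts (Upsilon R). real (\<Sum>w\<in>vertices_over S T R g. m w) *\<^sub>R h g)"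
    by (intro sum.cong HOL.refl) (auto simp: vertices_over_def scaleR_sum_left)
  finally show ?thesis .
qed

lemma le_sum_vertices_over:
  fixes m :: "'a word \<Rightarrow> nat"
  assumes "finite R" "w \<in> verts (Upsilon R)"
  shows "m w \<le> (\<Sum>v\<in>vertices_over S T R (word_img S T w). m v)"
  using assms finite_triple_words[OF assms(1)]
  by (intro member_le_sum) (auto simp: vertices_over_def Upsilon_def)

section \<open>Property (T) of the quotient from the spectral gap\<close>

theorem theorem3p5:
  fixes S :: "'a set" and T :: "'a word set" and G :: "'a word set monoid"
    and L :: "'a word set" and R :: "'a triple set" and \<epsilon> \<delta> :: real
  assumes "finite_presentation S T"
    and "G = presented_group S T"
    and "hyperbolic_presentation S T"
    and "L \<subseteq> lists (letters S)"
    and "regular_language (letters S) L"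
    and "prefix_closed L"
    and "suffix_closed L"
    and "\<forall>w\<in>L. geodesic_word S T w"
    and "\<forall>l\<ge>1. finite_index G (generate G (word_img S T ` {w \<in> L. length w = l}))"
    and "finite R"
    and "\<forall>(x, y, z)\<in>R. x \<in> L \<and> y \<in> L \<and> z \<in> L"
    and "\<forall>(x, y, z)\<in>R. reduced (x @ y @ z) \<and> x @ y @ z \<in> L"
    and "\<forall>(x, y, z)\<in>R. \<forall>w\<in>{x, y, z}. reduced w \<and> w \<noteq> []"
    and "finite_index G (generate G (word_img S T ` triple_words R))"
    and "\<epsilon> > 0" and "\<delta> > 0"
    and "2 - 4 * \<epsilon>\<^sup>2 > 0"
    and "\<forall>g\<in>carrier G. g \<in> word_img S T ` verts (Upsilon R) \<longrightarrow>
           real (deg_elem S T R g) \<le> (1 + \<epsilon>) * real (deg_elem S T R (inv\<^bsub>G\<^esub> g)) \<and>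
           real (rep_elem S T R g) \<le> (1 + \<delta>) * real (deg_elem S T R g)"
    and "lambda1 (Upsilon R) > (1 + \<delta>) / (2 - 4 * \<epsilon>\<^sup>2)"
  shows "property_T TYPE('h::complex_hilbert)
           (G Mod (normal_closure G (word_img S T ` relator_words R)))"
proof -
  have T: "T \<subseteq> lists (letters S)" using assms(1) by (simp add: finite_presentation_def)
  interpret group G unfolding assms(2) by (rule group_presented_group[OF T])
  let ?\<eta> = "word_img S T" and ?V = "verts (Upsilon R)"
  define N where "N = normal_closure G (?\<eta> ` relator_words R)"
  define K where "K = ?\<eta> ` ?V"
  define H where "H = generate G (?\<eta> ` triple_words R)"
  have letters_R: "x \<in> lists (letters S)" "y \<in> lists (letters S)" "z \<in> lists (letters S)"
    if "(x, y, z) \<in> R" for x y z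
    using that assms(4,11) by blast+
  have triple_words: "triple_words R \<subseteq> lists (letters S)"
    using letters_R unfolding triple_words_def by blast
  have V_eq: "?V = triple_words R \<union> inv_word ` triple_words R" by (simp add: Upsilon_def)
  have V: "?V \<subseteq> lists (letters S)" "finite ?V"
    unfolding V_eq using triple_words finite_triple_words[OF assms(10)] inv_word_in by blast+
  have V_inv: "inv_word w \<in> ?V" if "w \<in> ?V" for w using that by (auto simp: V_eq)
  have \<eta>_in: "?\<eta> w \<in> carrier G" if "w \<in> lists (letters S)" for w
    using that word_img_in_carrier[of w S T] assms(2) by simp
  have \<eta>_inv: "?\<eta> (inv_word w) = inv\<^bsub>G\<^esub> ?\<eta> w" if "w \<in> lists (letters S)" for w
    using that word_img_inv_word[OF T] assms(2) by simp
  have \<eta>_mult: "?\<eta> (u @ v) = ?\<eta> u \<otimes>\<^bsub>G\<^esub> ?\<eta> v" if "u \<in> lists (letters S)" "v \<in> lists (letters S)" for u v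
    using that word_img_mult[OF T] assms(2) by simp
  have K: "finite K" "K \<subseteq> carrier G" unfolding K_def using V \<eta>_in by blast+
  have K_inv: "inv\<^bsub>G\<^esub> g \<in> K" if g: "g \<in> K" for g
  proof -
    obtain w where w: "w \<in> ?V" "g = ?\<eta> w" using g unfolding K_def by blast
    then have "inv\<^bsub>G\<^esub> g = ?\<eta> (inv_word w)" using V(1) \<eta>_inv by blast
    then show ?thesis using V_inv[OF w(1)] by (simp add: K_def)
  qed
  have rel: "?\<eta> ` relator_words R \<subseteq> carrier G"
  proof -
    have "relator_words R \<subseteq> lists (letters S)" using assms(4,12) by (force simp: relator_words_def)
    then show ?thesis using \<eta>_in by blast
  qed
  interpret N: normal N G unfolding N_def by (rule normal_closure[OF rel])
  \<comment> \<open>Stated for representations of \<open>G\<close> itself in which the relators act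
    trivially; the constant must not depend on \<open>u\<close>, which is chosen after it.\<close>
  have nearby: "\<exists>C\<ge>0. \<forall>u t. 0 \<le> t \<longrightarrow> (\<forall>g\<in>K. norm (U g u - u) \<le> t) \<longrightarrow>
      (\<exists>v. (\<forall>h\<in>H. U h v = v) \<and> norm (v - u) \<le> C * t)"
    if U: "unitary_rep G U" and U_rel: "\<And>x y z u. (x, y, z) \<in> R \<Longrightarrow> U (?\<eta> (x @ y @ z)) u = u"
    for U :: "'a word set \<Rightarrow> 'h \<Rightarrow> 'h"
  proof -
    interpret U: unitary_representation G U by unfold_locales (rule U)
    show ?thesis
    proof (cases "R = {}")
      \<comment> \<open>here \<open>lambda1\<close> is the unspecified element of an empty list, but \<open>H\<close> is trivial\<close>
      case True
      then have "U h v = v" if "h \<in> H" for h v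
        using that by (intro U.generate_fixes[of "{}"]) (auto simp: H_def triple_words_def)
      then show ?thesis by (intro exI[of _ 0]) auto
    next
      case False
      define d where "d g = real (deg_elem S T R g)" for g
      define \<mu> where "\<mu> = lambda1 (Upsilon R)"
      have bounds: "d g \<le> (1 + \<epsilon>) * d (inv\<^bsub>G\<^esub> g)" "real (rep_elem S T R g) \<le> (1 + \<delta>) * d g"
        if "g \<in> K" for g
        using assms(18) that K(2) by (auto simp: K_def d_def)
      have "0 < (1 + \<delta>) / (2 - 4 * \<epsilon>\<^sup>2)" using assms(16,17) by simp
      then have \<mu>: "0 < \<mu>" using assms(19) unfolding \<mu>_def by linarith
      \<comment> \<open>Clearing the denominator in the spectral hypothesis gives the factor
        \<open>1 - 2 * \<epsilon>\<^sup>2\<close>, which is at most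
        \<open>1 - \<epsilon>\<^sup>2\<close>.\<close>
      have gap: "(1 + \<delta>) / 2 / \<mu> < 1 - \<epsilon>\<^sup>2"
      proof -
        have "(1 + \<delta>) / 2 < \<mu> * (1 - 2 * \<epsilon>\<^sup>2)"
          using assms(17,19) by (simp add: \<mu>_def field_simps)
        also have "\<dots> \<le> \<mu> * (1 - \<epsilon>\<^sup>2)" using \<mu> by simp
        finally show ?thesis using \<mu> by (simp add: field_simps)
      qed
      have sum_deg: "(\<Sum>v\<in>?V. real (out_degree (Upsilon R) v) *\<^sub>R h (?\<eta> v)) = (\<Sum>g\<in>K. d g *\<^sub>R h g)"
        for h :: "'a word set \<Rightarrow> 'b::real_vector"
        unfolding sum_vertices_over[OF assms(10)] by (simp add: K_def d_def deg_elem_def)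
      interpret fin_digraph "Upsilon R" by (rule fin_digraph_Upsilon[OF assms(10)])
      have sum_d: "sum d K = real (card (arcs (Upsilon R)))"
        using sum_deg[of "\<lambda>_. 1 :: real"] sum_arcs_by_tail[of "\<lambda>_. 1"] by simp
      have N_pos: "0 < sum d K"
        using False assms(10) by (simp add: sum_d card_arcs_Upsilon card_gt_0_iff)
      define E where "E u = (\<Sum>g\<in>K. d g * (norm (U g u - u))\<^sup>2)" for u
      have poincare: "\<mu> * (E u - (norm (\<Sum>g\<in>K. d g *\<^sub>R (U g u - u)))\<^sup>2 / sum d K) \<le> (1 + \<delta>) / 2 * E u" for u
      proof -
        define f where "f w = U (?\<eta> w) u - u" for w
        \<comment> \<open>Since \<open>x @ y @ z\<close> acts trivially, the inverse of
          \<open>z\<close> acts as \<open>x\<close> after \<open>y\<close>; the difference is then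
          \<open>U (?\<eta> x)\<close> applied to \<open>u - U (?\<eta> y) u\<close>.\<close>
        have edge: "norm (f x - f (inv_word z)) = norm (f y)" if r: "(x, y, z) \<in> R" for x y z
        proof -
          note xyz = letters_R[OF r]
          have "U (?\<eta> (inv_word z)) u = U (?\<eta> (x @ y @ z)) (U (?\<eta> (inv_word z)) u)"
            by (simp add: U_rel[OF r])
          also have "\<dots> = U (?\<eta> x) (U (?\<eta> y) (U (?\<eta> z) (U (?\<eta> (inv_word z)) u)))"
            using xyz by (simp add: \<eta>_mult \<eta>_in U.rep_mult del: in_lists_conv_set)
          also have "U (?\<eta> z) (U (?\<eta> (inv_word z)) u) = u"
            using xyz U.rep_inv[of "?\<eta> (inv_word z)" u]
            by (simp add: \<eta>_inv \<eta>_in del: in_lists_conv_set)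
          finally have "norm (f x - f (inv_word z)) = norm (U (?\<eta> x) u - U (?\<eta> x) (U (?\<eta> y) u))"
            by (simp add: f_def)
          also have "\<dots> = norm (f y)"
            using xyz by (simp add: unitary_norm_diff[OF U.unitary] \<eta>_in f_def norm_minus_commute
                del: in_lists_conv_set)
          finally show ?thesis .
        qed
        have sym: "norm (f (inv_word y)) = norm (f y)" if "y \<in> lists (letters S)" for y
          using that by (simp add: f_def \<eta>_inv \<eta>_in U.norm_inv_diff del: in_lists_conv_set)
        \<comment> \<open>Each triple yields two opposite arcs, which absorbs the factor
          1/2.\<close>
        have "(\<Sum>e\<in>arcs (Upsilon R). (norm (f (tail (Upsilon R) e) - f (head (Upsilon R) e)))\<^sup>2) / 2 =
            (\<Sum>(x, y, z)\<in>R. (norm (f x - f (inv_word z)))\<^sup>2)"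
          by (subst sum_arcs_Upsilon) (auto simp: norm_minus_commute)
        also have "\<dots> = (\<Sum>(x, y, z)\<in>R. (norm (f y))\<^sup>2)"
          by (intro sum.cong HOL.refl) (auto simp: edge)
        \<comment> \<open>An element and its inverse displace \<open>u\<close> equally, so the sum
          can be split evenly between \<open>y\<close> and its inverse, as \<open>rep_word\<close>
          counts them.\<close>
        also have "\<dots> = (\<Sum>(x, y, z)\<in>R. (norm (f y))\<^sup>2 + (norm (f (inv_word y)))\<^sup>2) / 2"
          unfolding sum_divide_distrib
          by (intro sum.cong HOL.refl) (auto simp: sym letters_R simp del: in_lists_conv_set)
        also have "\<dots> = (\<Sum>v\<in>?V. real (rep_word R v) * (norm (f v))\<^sup>2) / 2"
          by (simp add: sum_rep_word[OF assms(10)])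
        also have "\<dots> = (\<Sum>g\<in>K. real (rep_elem S T R g) * (norm (U g u - u))\<^sup>2) / 2"
          using sum_vertices_over[OF assms(10), of "rep_word R" "\<lambda>g. (norm (U g u - u))\<^sup>2" S T]
          by (simp add: f_def K_def rep_elem_def)
        also have "\<dots> \<le> (\<Sum>g\<in>K. (1 + \<delta>) * d g * (norm (U g u - u))\<^sup>2) / 2"
          by (intro divide_right_mono sum_mono mult_right_mono bounds) auto
        also have "\<dots> = (1 + \<delta>) / 2 * E u"
          by (simp add: E_def mult.assoc flip: sum_distrib_left)
        finally have upper: "(\<Sum>e\<in>arcs (Upsilon R). (norm (f (tail (Upsilon R) e) - f (head (Upsilon R) e)))\<^sup>2) / 2
            \<le> (1 + \<delta>) / 2 * E u" .
        have "(\<Sum>v\<in>?V. real (out_degree (Upsilon R) v) * (norm (f v))\<^sup>2) = E u"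
          using sum_deg[of "\<lambda>g. (norm (U g u - u))\<^sup>2"] by (simp add: f_def E_def)
        moreover have "(\<Sum>v\<in>?V. real (out_degree (Upsilon R) v) *\<^sub>R f v) = (\<Sum>g\<in>K. d g *\<^sub>R (U g u - u))"
          using sum_deg[of "\<lambda>g. U g u - u"] by (simp add: f_def)
        ultimately show ?thesis
          using poincare_inequality[OF fin_digraph_Upsilon[OF assms(10)] _ Upsilon_symmetric, of f]
            upper \<mu> False by (simp add: \<mu>_def sum_d Upsilon_def)
      qed
      obtain C where C: "0 \<le> C" "\<And>u. \<exists>v. (\<forall>g\<in>K. 0 < d g \<longrightarrow> U g v = v) \<and> norm (v - u) \<le> C * sqrt (E u)"
        using nearby_invariant_vector[of K "\<lambda>g. inv\<^bsub>G\<^esub> g" U d \<epsilon> \<mu> "(1 + \<delta>) / 2" E] K K_inv \<mu> gap N_pos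
          poincare bounds(1) E_def assms(15) U.unitary
        by (auto simp: subset_iff d_def U.adjoint unitary_linear unitary_norm)
      \<comment> \<open>Only elements of positive degree are known to fix \<open>v\<close>. The word
        \<open>x\<close> is the tail of an arc; so is the inverse of \<open>z\<close>, and almost
        symmetry transfers this to \<open>z\<close>; for \<open>y\<close>, positivity of
        \<open>rep_elem\<close> forces positive degree.\<close>
      have fixed: "U k v = v" if v: "\<And>g. g \<in> K \<Longrightarrow> 0 < d g \<Longrightarrow> U g v = v"
        and k: "k \<in> ?\<eta> ` triple_words R" for v k
      proof -
        obtain x y z w where r: "(x, y, z) \<in> R" and w: "w \<in> {x, y, z}" "k = ?\<eta> w"
          using k unfolding triple_words_def by blast
        have verts: "x \<in> ?V" "y \<in> ?V" "z \<in> ?V" "inv_word z \<in> ?V"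
          using r by (force simp: Upsilon_def triple_words_def)+
        have deg_pos: "0 < d (?\<eta> (tail (Upsilon R) e))" if "e \<in> arcs (Upsilon R)" for e
        proof -
          let ?t = "tail (Upsilon R) e"
          have "0 < out_degree (Upsilon R) ?t"
          proof -
            have "e \<in> out_arcs (Upsilon R) ?t" using that by simp
            then show ?thesis unfolding out_degree_def card_gt_0_iff by blast
          qed
          also have "\<dots> \<le> deg_elem S T R (?\<eta> ?t)"
            unfolding deg_elem_def by (rule le_sum_vertices_over[OF assms(10)]) (use that in auto)
          finally show ?thesis by (simp add: d_def)
        qed
        have "0 < d (?\<eta> x)" using deg_pos[of "((x, y, z), True)"] r by (simp add: Upsilon_def)
        moreover have "0 < d (?\<eta> z)"
        proof -
          have "0 < d (?\<eta> (inv_word z))" using deg_pos[of "((x, y, z), False)"] r by (simp add: Upsilon_def)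
          also have "\<dots> \<le> (1 + \<epsilon>) * d (?\<eta> z)"
            using bounds(1)[OF imageI[OF verts(4), of ?\<eta>, folded K_def]] letters_R[OF r]
            by (simp add: \<eta>_inv \<eta>_in del: in_lists_conv_set)
          finally show ?thesis using assms(15) by (simp add: zero_less_mult_iff)
        qed
        moreover have "0 < d (?\<eta> y)"
        proof -
          have "0 < rep_word R y"
            using r assms(10) unfolding rep_word_def
            by (intro add_pos_nonneg) (auto simp: card_gt_0_iff intro: finite_subset[of _ R])
          also have "\<dots> \<le> rep_elem S T R (?\<eta> y)"
            unfolding rep_elem_def by (rule le_sum_vertices_over[OF assms(10) verts(2)])
          finally have "0 < (1 + \<delta>) * d (?\<eta> y)"
            using bounds(2)[of "?\<eta> y"] verts(2) by (force simp: K_def)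
          then show ?thesis using assms(16) by (simp add: zero_less_mult_iff)
        qed
        ultimately show ?thesis using v w verts by (auto simp: K_def)
      qed
      show ?thesis
      proof (intro exI[of _ "C * sqrt (sum d K)"] conjI allI impI)
        show "0 \<le> C * sqrt (sum d K)" using C(1) N_pos by simp
        fix u t assume t: "0 \<le> t" "\<forall>g\<in>K. norm (U g u - u) \<le> t"
        obtain v where v: "\<And>g. g \<in> K \<Longrightarrow> 0 < d g \<Longrightarrow> U g v = v" "norm (v - u) \<le> C * sqrt (E u)"
          using C(2)[of u] by blast
        have "U h v = v" if "h \<in> H" for h
        proof (rule U.generate_fixes)
          show "h \<in> generate G (?\<eta> ` triple_words R)" using that by (simp add: H_def)
          show "k \<in> carrier G \<and> U k v = v" if "k \<in> ?\<eta> ` triple_words R" for k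
            using fixed[OF v(1) that] that triple_words \<eta>_in by blast
        qed
        moreover have "E u \<le> sum d K * t\<^sup>2"
          unfolding E_def sum_distrib_right using t
          by (intro sum_mono mult_left_mono power_mono) (auto simp: d_def)
        then have "sqrt (E u) \<le> sqrt (sum d K) * t"
          using t(1) by (metis real_sqrt_le_mono real_sqrt_mult real_sqrt_abs abs_of_nonneg)
        then have "norm (v - u) \<le> C * sqrt (sum d K) * t"
          using v(2) C(1) by (metis mult.assoc mult_left_mono order_trans)
        ultimately show "\<exists>v. (\<forall>h\<in>H. U h v = v) \<and> norm (v - u) \<le> C * sqrt (sum d K) * t" by blast
      qed
    qed
  qed
  have main: "has_invariant_vector (G Mod N) \<pi>"
    if A: "finite_generating_set (G Mod N) A" and \<pi>: "unitary_rep (G Mod N) \<pi>"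
      and ai: "almost_invariant_vectors A \<pi>" for A and \<pi> :: "'a word set set \<Rightarrow> 'h \<Rightarrow> 'h"
  proof -
    interpret Q: unitary_representation "G Mod N" \<pi>
      using N.factorgroup_is_group \<pi> by (simp add: unitary_representation_def unitary_representation_axioms_def)
    \<comment> \<open>The pullback to \<open>G\<close>; each relator lies in \<open>N\<close> and
      hence acts as the identity.\<close>
    define U where "U g = \<pi> (N #>\<^bsub>G\<^esub> g)" for g
    have U: "unitary_rep G U" unfolding U_def by (rule N.unitary_rep_pullback[OF \<pi>])
    interpret U: unitary_representation G U by unfold_locales (rule U)
    have "U (?\<eta> (x @ y @ z)) u = u" if "(x, y, z) \<in> R" for x y z u
    proof -
      have "?\<eta> (x @ y @ z) \<in> N"
        using normal_closure(2)[OF rel] that by (force simp: N_def relator_words_def)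
      then show ?thesis
        using N.rcos_const[OF is_group] Q.rep_one by (simp add: U_def FactGroup_def)
    qed
    from nearby[OF U this] obtain C where C: "0 \<le> C"
      "\<And>u t. 0 \<le> t \<Longrightarrow> \<forall>g\<in>K. norm (U g u - u) \<le> t \<Longrightarrow> \<exists>v. (\<forall>h\<in>H. U h v = v) \<and> norm (v - u) \<le> C * t"
      by blast
    have "has_invariant_vector G U"
    proof (rule U.has_invariant_vector_if_nearby[OF _ _ K(1,2) C(1)])
      show "finite_index G H" using assms(14) by (simp add: H_def)
      fix F :: "'a word set set" and \<theta> :: real
      assume F: "finite F" "F \<subseteq> carrier G" "0 < \<theta>"
      \<comment> \<open>Almost invariance is available in the quotient; a vector chosen for the
        image of \<open>F\<close> serves \<open>F\<close>, since \<open>U g\<close> depends only on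
        the coset of \<open>g\<close>.\<close>
      have "(\<lambda>g. N #>\<^bsub>G\<^esub> g) ` F \<subseteq> carrier (G Mod N)"
        using F(2) rcosetsI[OF N.subset] by (auto simp: FactGroup_def)
      then obtain u where "u \<noteq> 0" "\<And>c. c \<in> (\<lambda>g. N #>\<^bsub>G\<^esub> g) ` F \<Longrightarrow> norm (\<pi> c u - u) \<le> \<theta> * norm u"
        using Q.almost_invariant_on_finite[OF A ai finite_imageI[OF F(1)] _ F(3)] by blast
      then show "\<exists>u. u \<noteq> 0 \<and> (\<forall>g\<in>F. norm (U g u - u) \<le> \<theta> * norm u)" by (auto simp: U_def)
    qed (use C(2) in blast)
    \<comment> \<open>Every element of the quotient is a coset \<open>N #> g\<close>, so invariance
      under \<open>U\<close> is invariance under \<open>\<pi>\<close>.\<close>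
    then show ?thesis by (auto simp: has_invariant_vector_def U_def FactGroup_def RCOSETS_def)
  qed
  show ?thesis
    unfolding property_T_def N_def[symmetric]
    using N.factorgroup_is_group main
      N.finite_generating_set_Mod[OF finite_generating_set_presented_group[OF assms(1), folded assms(2)]]
    by blast
qed

end
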